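(* Let $(\mathcal T,\Sigma,\Delta)$ be a pre-triangulated category. Let $q$ be an initial square in $\mathcal T$, with local octahedral obstruction $o_\Delta(q)\in\operatorname{Obs}_\Delta(q)$. Then $q$ has a good completion if and only if $o_\Delta(q)=0$. Moreover, the following are equivalent. (i) $\Delta$ satisfies $\mathrm{TR4}$. (ii) One has $o_\Delta(q)=0$ for every initial square $q$. (iii) One has $o_\Delta(q(g\circ f))=0$ for every composable pair $X\xrightarrow{f}Y\xrightarrow{g}Z$.
   Context: All categories are additive and essentially small; $gf=g\circ f$ means first $f$, then $g$. A suspended category $(\mathcal T,\Sigma)$ is an additive category with an additive autoequivalence $\Sigma$. A candidate triangle is a sequence $X\xrightarrow{u}Y\xrightarrow{v}Z\xrightarrow{w}\Sigma X$ with $vu=0$, $wv=0$, $\Sigma(u)w=0$. A morphism from it to $X'\xrightarrow{u'}Y'\xrightarrow{v'}Z'\xrightarrow{w'}\Sigma X'$ is a triple $(f,g,h)$ with $gu=u'f$, $hv=v'g$, $w'h=\Sigma(f)w$. A pre-triangulation $\Delta$ on $(\mathcal T,\Sigma)$ is a class of candidate triangles, called distinguished, satisfying: (TR1) $\Delta$ is closed under isomorphism, contains $X\xrightarrow{1}X\to0\to\Sigma X$ for all $X$, and every morphism is the first map of a distinguished triangle; (TR2) $(u,v,w)$ is distinguished iff $(v,w,-\Sigma(u))$ is; (TR3) every commutative square on the first maps of two distinguished triangles extends to a morphism of candidate triangles. (TR4) is Verdier's octahedral axiom: given distinguished $X\xrightarrow{u}Y\xrightarrow{i}X'\xrightarrow{i'}\Sigma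 X$, $Y\xrightarrow{v}Z\xrightarrow{j}Z'\xrightarrow{j'}\Sigma Y$, $X\xrightarrow{vu}Z\xrightarrow{k}Y'\xrightarrow{k'}\Sigma X$, there are $u':X'\to Y'$ and $v':Y'\to Z'$ with $u'i=kv$, $v'k=j$, $k'u'=i'$, $j'v'=\Sigma(u)k'$ and $X'\xrightarrow{u'}Y'\xrightarrow{v'}Z'\xrightarrow{\Sigma(i)j'}\Sigma X'$ distinguished. $(\mathcal T,\Sigma,\Delta)$ is then called pre-triangulated. An initial square $q$ consists of two chosen distinguished triangles $X\xrightarrow{u}Y\xrightarrow{v}Z\xrightarrow{w}\Sigma X$ and $X'\xrightarrow{u'}Y'\xrightarrow{v'}Z'\xrightarrow{w'}\Sigma X'$ and maps $f:X\to X'$, $g:Y\to Y'$ with $gu=u'f$. A completion of $q$ is $h:Z\to Z'$ such that $(f,g,h)$ is a morphism of candidate triangles. Put $A=Y\oplus X'$, $B=Z\oplus Y'$, $C=\Sigma X\oplus Z'$ and $$\alpha=\begin{bmatrix}-v & 0 \\ g & u'\end{bmatrix},\quad \beta(h)=\begin{bmatrix}-w & 0 \\ h & v'\end{bmatrix},\quad \gamma=\begin{bmatrix}-\Sigma(u) & 0 \\ \Sigma(f) & w'\end{bmatrix}.$$ The completion $h$ is good if the mapping-cone candidate triangle $A\xrightarrow{\alpha}B\xrightarrow{\beta(h)}C\xrightarrow{\gamma}\Sigma A$ is distinguished. Obstruction: put $\beta_0=\begin{bmatrix}-w & 0 \\ 0 & v'\end{bmatrix}$ and $J_q=\left\{\begin{bmatrix}0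 & 0 \\ a & 0\end{bmatrix}: a\in\mathcal T(Z,Z')\right\}\subseteq\mathcal T(B,C)$; write $\bar b$ for the class of $b$ in $\mathcal T(B,C)/J_q$. Choose a distinguished triangle $A\xrightarrow{\alpha}B\xrightarrow{s}E\xrightarrow{t}\Sigma A$. Define $$\delta_q:\mathcal T(E,C)\to \mathcal T(B,C)/J_q\oplus\mathcal T(E,\Sigma A),\qquad \phi\mapsto(\overline{\phi s},\gamma\phi),$$ $\operatorname{Obs}_\Delta(q)=\operatorname{coker}\delta_q$, and let $o_\Delta(q)$ be the class of $(\bar\beta_0,t)$. (Its vanishing does not depend on the chosen triangle.) For a composable pair $X\xrightarrow{f}Y\xrightarrow{g}Z$, $q(g\circ f)$ denotes the initial square formed by distinguished triangles $X\xrightarrow{f}Y\xrightarrow{a}F\xrightarrow{b}\Sigma X$ and $X\xrightarrow{gf}Z\xrightarrow{c}H\xrightarrow{d}\Sigma X$ with vertical maps $1_X:X\to X$ and $g:Y\to Z$. (The vanishing of $o_\Delta(q(g\circ f))$ is independent of the choices.) *)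

theory Defs
  imports "HOL-Algebra.Coset"
begin

text \<open>
  A category lives on a set of objects and a set of arrows, so it is small. An essentially small
  category is equivalent to one of this kind. Nothing is required of the operations outside these
  sets. Composition is in the usual order: in \<open>Comp g f\<close> the arrow \<open>f\<close> comes first.
\<close>

record ('o, 'm) cat =
  Obj :: "'o set"
  Arr :: "'m set"
  Dom :: "'m \<Rightarrow> 'o"
  Cod :: "'m \<Rightarrow> 'o"
  Idt :: "'o \<Rightarrow> 'm"
  Comp :: "'m \<Rightarrow> 'm \<Rightarrow> 'm"  (infixl "\<cdot>\<index>" 70)

definition mor :: "('o, 'm, 'x) cat_scheme \<Rightarrow> 'o \<Rightarrow> 'o \<Rightarrow> 'm set" where
  "mor C X Y = {f \<in> Arr C. Dom C f = X \<and> Cod C f = Y}"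

definition category :: "('o, 'm, 'x) cat_scheme \<Rightarrow> bool" where
  "category C \<longleftrightarrow>
     (\<forall>f\<in>Arr C. Dom C f \<in> Obj C \<and> Cod C f \<in> Obj C) \<and>
     (\<forall>X\<in>Obj C. Idt C X \<in> mor C X X) \<and>
     (\<forall>X Y Z. \<forall>f\<in>mor C X Y. \<forall>g\<in>mor C Y Z. g \<cdot>\<^bsub>C\<^esub> f \<in> mor C X Z) \<and>
     (\<forall>X Y. \<forall>f\<in>mor C X Y. f \<cdot>\<^bsub>C\<^esub> Idt C X = f \<and> Idt C Y \<cdot>\<^bsub>C\<^esub> f = f) \<and>
     (\<forall>W X Y Z. \<forall>f\<in>mor C W X. \<forall>g\<in>mor C X Y. \<forall>h\<in>mor C Y Z.
        h \<cdot>\<^bsub>C\<^esub> (g \<cdot>\<^bsub>C\<^esub> f) = (h \<cdot>\<^bsub>C\<^esub> g) \<cdot>\<^bsub>C\<^esub> f)"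

definition iso_arrow :: "('o, 'm, 'x) cat_scheme \<Rightarrow> 'm \<Rightarrow> bool" where
  "iso_arrow C f \<longleftrightarrow> f \<in> Arr C \<and>
     (\<exists>g\<in>mor C (Cod C f) (Dom C f).
        g \<cdot>\<^bsub>C\<^esub> f = Idt C (Dom C f) \<and> f \<cdot>\<^bsub>C\<^esub> g = Idt C (Cod C f))"

record ('o, 'm, 'p, 'n) cat_functor =
  omap :: "'o \<Rightarrow> 'p"
  amap :: "'m \<Rightarrow> 'n"

definition is_functor ::
  "('o, 'm, 'x) cat_scheme \<Rightarrow> ('p, 'n, 'y) cat_scheme \<Rightarrow> ('o, 'm, 'p, 'n) cat_functor \<Rightarrow> bool" where
  "is_functor C D F \<longleftrightarrow>
     (\<forall>X\<in>Obj C. omap F X \<in> Obj D) \<and>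
     (\<forall>X Y. \<forall>f\<in>mor C X Y. amap F f \<in> mor D (omap F X) (omap F Y)) \<and>
     (\<forall>X\<in>Obj C. amap F (Idt C X) = Idt D (omap F X)) \<and>
     (\<forall>X Y Z. \<forall>f\<in>mor C X Y. \<forall>g\<in>mor C Y Z.
        amap F (g \<cdot>\<^bsub>C\<^esub> f) = amap F g \<cdot>\<^bsub>D\<^esub> amap F f)"

definition functor_id :: "('o, 'm, 'o, 'm) cat_functor" where
  "functor_id = \<lparr>omap = (\<lambda>X. X), amap = (\<lambda>f. f)\<rparr>"

definition functor_comp ::
  "('p, 'n, 'q, 'k) cat_functor \<Rightarrow> ('o, 'm, 'p, 'n) cat_functor \<Rightarrow> ('o, 'm, 'q, 'k) cat_functor" where
  "functor_comp G F = \<lparr>omap = omap G \<circ> omap F, amap = amap G \<circ> amap F\<rparr>"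

definition natural_iso ::
  "('o, 'm, 'x) cat_scheme \<Rightarrow> ('p, 'n, 'y) cat_scheme \<Rightarrow>
   ('o, 'm, 'p, 'n) cat_functor \<Rightarrow> ('o, 'm, 'p, 'n) cat_functor \<Rightarrow> ('o \<Rightarrow> 'n) \<Rightarrow> bool" where
  "natural_iso C D F G \<eta> \<longleftrightarrow>
     (\<forall>X\<in>Obj C. \<eta> X \<in> mor D (omap F X) (omap G X) \<and> iso_arrow D (\<eta> X)) \<and>
     (\<forall>X Y. \<forall>f\<in>mor C X Y. \<eta> Y \<cdot>\<^bsub>D\<^esub> amap F f = amap G f \<cdot>\<^bsub>D\<^esub> \<eta> X)"

definition cat_equivalence ::
  "('o, 'm, 'x) cat_scheme \<Rightarrow> ('p, 'n, 'y) cat_scheme \<Rightarrow> ('o, 'm, 'p, 'n) cat_functor \<Rightarrow> bool" where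
  "cat_equivalence C D F \<longleftrightarrow> is_functor C D F \<and>
     (\<exists>G \<eta> \<epsilon>. is_functor D C G \<and>
        natural_iso C C functor_id (functor_comp G F) \<eta> \<and>
        natural_iso D D (functor_comp F G) functor_id \<epsilon>)"

record ('o, 'm) biproduct =
  apex :: 'o
  inj1 :: 'm
  inj2 :: 'm
  prj1 :: 'm
  prj2 :: 'm

text \<open>
  The direct sum \<open>X \<oplus> Y\<close> used in block matrices is an arbitrary chosen biproduct \<open>Bip X Y\<close>,
  part of the data.
\<close>

record ('o, 'm) additive_cat = "('o, 'm) cat" +
  Add :: "'m \<Rightarrow> 'm \<Rightarrow> 'm"  (infixl "\<boxplus>\<index>" 65)
  Zero :: "'o \<Rightarrow> 'o \<Rightarrow> 'm"
  Bip :: "'o \<Rightarrow> 'o \<Rightarrow> ('o, 'm) biproduct"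

text \<open>The additive group of arrows from \<open>X\<close> to \<open>Y\<close>, in the multiplicative format of
  \<open>HOL-Algebra\<close>.\<close>

definition hom_group :: "('o, 'm, 'x) additive_cat_scheme \<Rightarrow> 'o \<Rightarrow> 'o \<Rightarrow> 'm monoid" where
  "hom_group T X Y = \<lparr>carrier = mor T X Y, monoid.mult = Add T, one = Zero T X Y\<rparr>"

definition neg :: "('o, 'm, 'x) additive_cat_scheme \<Rightarrow> 'm \<Rightarrow> 'm" where
  "neg T f = inv\<^bsub>hom_group T (Dom T f) (Cod T f)\<^esub> f"

definition zero_object :: "('o, 'm, 'x) cat_scheme \<Rightarrow> 'o \<Rightarrow> bool" where
  "zero_object T N \<longleftrightarrow> N \<in> Obj T \<and>
     (\<forall>X\<in>Obj T. (\<exists>!f. f \<in> mor T N X) \<and> (\<exists>!f. f \<in> mor T X N))"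

definition is_biproduct ::
  "('o, 'm, 'x) additive_cat_scheme \<Rightarrow> 'o \<Rightarrow> 'o \<Rightarrow> ('o, 'm) biproduct \<Rightarrow> bool" where
  "is_biproduct T X Y P \<longleftrightarrow> apex P \<in> Obj T \<and>
     inj1 P \<in> mor T X (apex P) \<and> inj2 P \<in> mor T Y (apex P) \<and>
     prj1 P \<in> mor T (apex P) X \<and> prj2 P \<in> mor T (apex P) Y \<and>
     prj1 P \<cdot>\<^bsub>T\<^esub> inj1 P = Idt T X \<and> prj2 P \<cdot>\<^bsub>T\<^esub> inj2 P = Idt T Y \<and>
     prj2 P \<cdot>\<^bsub>T\<^esub> inj1 P = Zero T X Y \<and> prj1 P \<cdot>\<^bsub>T\<^esub> inj2 P = Zero T Y X \<and>
     (inj1 P \<cdot>\<^bsub>T\<^esub> prj1 P) \<boxplus>\<^bsub>T\<^esub> (inj2 P \<cdot>\<^bsub>T\<^esub> prj2 P) = Idt T (apex P)"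

definition additive_category :: "('o, 'm, 'x) additive_cat_scheme \<Rightarrow> bool" where
  "additive_category T \<longleftrightarrow> category T \<and>
     (\<forall>X\<in>Obj T. \<forall>Y\<in>Obj T. comm_group (hom_group T X Y)) \<and>
     (\<forall>X Y Z. \<forall>f\<in>mor T X Y. \<forall>f'\<in>mor T X Y. \<forall>g\<in>mor T Y Z. \<forall>g'\<in>mor T Y Z.
        g \<cdot>\<^bsub>T\<^esub> (f \<boxplus>\<^bsub>T\<^esub> f') = (g \<cdot>\<^bsub>T\<^esub> f) \<boxplus>\<^bsub>T\<^esub> (g \<cdot>\<^bsub>T\<^esub> f') \<and>
        (g \<boxplus>\<^bsub>T\<^esub> g') \<cdot>\<^bsub>T\<^esub> f = (g \<cdot>\<^bsub>T\<^esub> f) \<boxplus>\<^bsub>T\<^esub> (g' \<cdot>\<^bsub>T\<^esub> f)) \<and>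
     (\<exists>N. zero_object T N) \<and>
     (\<forall>X\<in>Obj T. \<forall>Y\<in>Obj T. is_biproduct T X Y (Bip T X Y))"

record ('o, 'm) suspended_cat = "('o, 'm) additive_cat" +
  Susp :: "('o, 'm, 'o, 'm) cat_functor"

abbreviation SuspO :: "('o, 'm) suspended_cat \<Rightarrow> 'o \<Rightarrow> 'o"  ("\<Sigma>o\<index>") where
  "SuspO T \<equiv> omap (Susp T)"

abbreviation SuspA :: "('o, 'm) suspended_cat \<Rightarrow> 'm \<Rightarrow> 'm"  ("\<Sigma>a\<index>") where
  "SuspA T \<equiv> amap (Susp T)"

definition suspended_category :: "('o, 'm) suspended_cat \<Rightarrow> bool" where
  "suspended_category T \<longleftrightarrow> additive_category T \<and> cat_equivalence T T (Susp T) \<and>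
     (\<forall>X Y. \<forall>f\<in>mor T X Y. \<forall>g\<in>mor T X Y. \<Sigma>a\<^bsub>T\<^esub> (f \<boxplus>\<^bsub>T\<^esub> g) = \<Sigma>a\<^bsub>T\<^esub> f \<boxplus>\<^bsub>T\<^esub> \<Sigma>a\<^bsub>T\<^esub> g)"

text \<open>A triangle is given by its three arrows, which determine its objects.\<close>

type_synonym 'm triangle = "'m \<times> 'm \<times> 'm"

fun triangle_seq :: "('o, 'm) suspended_cat \<Rightarrow> 'm triangle \<Rightarrow> bool" where
  "triangle_seq T (u, v, w) \<longleftrightarrow> u \<in> Arr T \<and> v \<in> Arr T \<and> w \<in> Arr T \<and>
     Cod T u = Dom T v \<and> Cod T v = Dom T w \<and> Cod T w = \<Sigma>o\<^bsub>T\<^esub> (Dom T u)"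

fun candidate_triangle :: "('o, 'm) suspended_cat \<Rightarrow> 'm triangle \<Rightarrow> bool" where
  "candidate_triangle T (u, v, w) \<longleftrightarrow> triangle_seq T (u, v, w) \<and>
     v \<cdot>\<^bsub>T\<^esub> u = Zero T (Dom T u) (Cod T v) \<and>
     w \<cdot>\<^bsub>T\<^esub> v = Zero T (Dom T v) (Cod T w) \<and>
     \<Sigma>a\<^bsub>T\<^esub> u \<cdot>\<^bsub>T\<^esub> w = Zero T (Dom T w) (\<Sigma>o\<^bsub>T\<^esub> (Cod T u))"

fun triangle_morphism ::
  "('o, 'm) suspended_cat \<Rightarrow> 'm triangle \<Rightarrow> 'm triangle \<Rightarrow> 'm \<Rightarrow> 'm \<Rightarrow> 'm \<Rightarrow> bool" where
  "triangle_morphism T (u, v, w) (u', v', w') f g h \<longleftrightarrow>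
     f \<in> mor T (Dom T u) (Dom T u') \<and> g \<in> mor T (Dom T v) (Dom T v') \<and>
     h \<in> mor T (Dom T w) (Dom T w') \<and>
     g \<cdot>\<^bsub>T\<^esub> u = u' \<cdot>\<^bsub>T\<^esub> f \<and> h \<cdot>\<^bsub>T\<^esub> v = v' \<cdot>\<^bsub>T\<^esub> g \<and>
     w' \<cdot>\<^bsub>T\<^esub> h = \<Sigma>a\<^bsub>T\<^esub> f \<cdot>\<^bsub>T\<^esub> w"

definition triangle_iso :: "('o, 'm) suspended_cat \<Rightarrow> 'm triangle \<Rightarrow> 'm triangle \<Rightarrow> bool" where
  "triangle_iso T t t' \<longleftrightarrow>
     (\<exists>f g h. triangle_morphism T t t' f g h \<and> iso_arrow T f \<and> iso_arrow T g \<and> iso_arrow T h)"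

definition TR1 :: "('o, 'm) suspended_cat \<Rightarrow> 'm triangle set \<Rightarrow> bool" where
  "TR1 T \<Delta> \<longleftrightarrow>
     (\<forall>t\<in>\<Delta>. \<forall>t'. candidate_triangle T t' \<and> triangle_iso T t t' \<longrightarrow> t' \<in> \<Delta>) \<and>
     (\<forall>X\<in>Obj T. \<forall>N. zero_object T N \<longrightarrow> (Idt T X, Zero T X N, Zero T N (\<Sigma>o\<^bsub>T\<^esub> X)) \<in> \<Delta>) \<and>
     (\<forall>u\<in>Arr T. \<exists>v w. (u, v, w) \<in> \<Delta>)"

definition TR2 :: "('o, 'm) suspended_cat \<Rightarrow> 'm triangle set \<Rightarrow> bool" where
  "TR2 T \<Delta> \<longleftrightarrow>
     (\<forall>u v w. triangle_seq T (u, v, w) \<longrightarrow>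
        ((u, v, w) \<in> \<Delta> \<longleftrightarrow> (v, w, neg T (\<Sigma>a\<^bsub>T\<^esub> u)) \<in> \<Delta>))"

definition TR3 :: "('o, 'm) suspended_cat \<Rightarrow> 'm triangle set \<Rightarrow> bool" where
  "TR3 T \<Delta> \<longleftrightarrow>
     (\<forall>u v w u' v' w' f g.
        (u, v, w) \<in> \<Delta> \<and> (u', v', w') \<in> \<Delta> \<and>
        f \<in> mor T (Dom T u) (Dom T u') \<and> g \<in> mor T (Cod T u) (Cod T u') \<and>
        g \<cdot>\<^bsub>T\<^esub> u = u' \<cdot>\<^bsub>T\<^esub> f \<longrightarrow>
        (\<exists>h. triangle_morphism T (u, v, w) (u', v', w') f g h))"

definition TR4 :: "('o, 'm) suspended_cat \<Rightarrow> 'm triangle set \<Rightarrow> bool" where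
  "TR4 T \<Delta> \<longleftrightarrow>
     (\<forall>u v i i' j j' k k'.
        Cod T u = Dom T v \<and>
        (u, i, i') \<in> \<Delta> \<and> (v, j, j') \<in> \<Delta> \<and> (v \<cdot>\<^bsub>T\<^esub> u, k, k') \<in> \<Delta> \<longrightarrow>
        (\<exists>u'\<in>mor T (Cod T i) (Cod T k). \<exists>v'\<in>mor T (Cod T k) (Cod T j).
           u' \<cdot>\<^bsub>T\<^esub> i = k \<cdot>\<^bsub>T\<^esub> v \<and> v' \<cdot>\<^bsub>T\<^esub> k = j \<and>
           k' \<cdot>\<^bsub>T\<^esub> u' = i' \<and> j' \<cdot>\<^bsub>T\<^esub> v' = \<Sigma>a\<^bsub>T\<^esub> u \<cdot>\<^bsub>T\<^esub> k' \<and>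
           (u', v', \<Sigma>a\<^bsub>T\<^esub> i \<cdot>\<^bsub>T\<^esub> j') \<in> \<Delta>))"

definition pre_triangulated :: "('o, 'm) suspended_cat \<Rightarrow> 'm triangle set \<Rightarrow> bool" where
  "pre_triangulated T \<Delta> \<longleftrightarrow> suspended_category T \<and>
     (\<forall>t\<in>\<Delta>. candidate_triangle T t) \<and> TR1 T \<Delta> \<and> TR2 T \<Delta> \<and> TR3 T \<Delta>"

text \<open>\<open>block T P Q a b c d\<close> is the arrow from \<open>apex P\<close> to \<open>apex Q\<close> with matrix rows
  \<open>(a, b)\<close> and \<open>(c, d)\<close>; columns are indexed by the summands of \<open>P\<close>, rows by those of \<open>Q\<close>.\<close>

definition block ::
  "('o, 'm, 'x) additive_cat_scheme \<Rightarrow> ('o, 'm) biproduct \<Rightarrow> ('o, 'm) biproduct \<Rightarrow>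
   'm \<Rightarrow> 'm \<Rightarrow> 'm \<Rightarrow> 'm \<Rightarrow> 'm" where
  "block T P Q a b c d =
     inj1 Q \<cdot>\<^bsub>T\<^esub> ((a \<cdot>\<^bsub>T\<^esub> prj1 P) \<boxplus>\<^bsub>T\<^esub> (b \<cdot>\<^bsub>T\<^esub> prj2 P)) \<boxplus>\<^bsub>T\<^esub>
     inj2 Q \<cdot>\<^bsub>T\<^esub> ((c \<cdot>\<^bsub>T\<^esub> prj1 P) \<boxplus>\<^bsub>T\<^esub> (d \<cdot>\<^bsub>T\<^esub> prj2 P))"

text \<open>\<open>\<Sigma>(X \<oplus> Y)\<close> is a biproduct of \<open>\<Sigma>X\<close> and \<open>\<Sigma>Y\<close>, in general not the chosen one.\<close>

definition susp_bip :: "('o, 'm) suspended_cat \<Rightarrow> ('o, 'm) biproduct \<Rightarrow> ('o, 'm) biproduct" where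
  "susp_bip T P = \<lparr>apex = \<Sigma>o\<^bsub>T\<^esub> (apex P), inj1 = \<Sigma>a\<^bsub>T\<^esub> (inj1 P), inj2 = \<Sigma>a\<^bsub>T\<^esub> (inj2 P),
     prj1 = \<Sigma>a\<^bsub>T\<^esub> (prj1 P), prj2 = \<Sigma>a\<^bsub>T\<^esub> (prj2 P)\<rparr>"

text \<open>Two triangles, followed by the vertical arrows on the first and on the second objects.\<close>

type_synonym 'm square = "'m triangle \<times> 'm triangle \<times> 'm \<times> 'm"

fun initial_square :: "('o, 'm) suspended_cat \<Rightarrow> 'm triangle set \<Rightarrow> 'm square \<Rightarrow> bool" where
  "initial_square T \<Delta> ((u, v, w), (u', v', w'), f, g) \<longleftrightarrow>
     (u, v, w) \<in> \<Delta> \<and> (u', v', w') \<in> \<Delta> \<and>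
     f \<in> mor T (Dom T u) (Dom T u') \<and> g \<in> mor T (Cod T u) (Cod T u') \<and>
     g \<cdot>\<^bsub>T\<^esub> u = u' \<cdot>\<^bsub>T\<^esub> f"

fun completion :: "('o, 'm) suspended_cat \<Rightarrow> 'm square \<Rightarrow> 'm \<Rightarrow> bool" where
  "completion T (t, t', f, g) h \<longleftrightarrow> triangle_morphism T t t' f g h"

fun coneA :: "('o, 'm) suspended_cat \<Rightarrow> 'm square \<Rightarrow> ('o, 'm) biproduct" where
  "coneA T ((u, v, w), (u', v', w'), f, g) = Bip T (Cod T u) (Dom T u')"

fun coneB :: "('o, 'm) suspended_cat \<Rightarrow> 'm square \<Rightarrow> ('o, 'm) biproduct" where
  "coneB T ((u, v, w), (u', v', w'), f, g) = Bip T (Cod T v) (Cod T u')"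

fun coneC :: "('o, 'm) suspended_cat \<Rightarrow> 'm square \<Rightarrow> ('o, 'm) biproduct" where
  "coneC T ((u, v, w), (u', v', w'), f, g) = Bip T (\<Sigma>o\<^bsub>T\<^esub> (Dom T u)) (Cod T v')"

fun cone_alpha :: "('o, 'm) suspended_cat \<Rightarrow> 'm square \<Rightarrow> 'm" where
  "cone_alpha T ((u, v, w), (u', v', w'), f, g) =
     (let q = ((u, v, w), (u', v', w'), f, g) in
      block T (coneA T q) (coneB T q)
        (neg T v) (Zero T (Dom T u') (Cod T v))
        g         u')"

fun cone_beta :: "('o, 'm) suspended_cat \<Rightarrow> 'm square \<Rightarrow> 'm \<Rightarrow> 'm" where
  "cone_beta T ((u, v, w), (u', v', w'), f, g) h =
     (let q = ((u, v, w), (u', v', w'), f, g) in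
      block T (coneB T q) (coneC T q)
        (neg T w) (Zero T (Cod T u') (\<Sigma>o\<^bsub>T\<^esub> (Dom T u)))
        h         v')"

fun cone_gamma :: "('o, 'm) suspended_cat \<Rightarrow> 'm square \<Rightarrow> 'm" where
  "cone_gamma T ((u, v, w), (u', v', w'), f, g) =
     (let q = ((u, v, w), (u', v', w'), f, g) in
      block T (coneC T q) (susp_bip T (coneA T q))
        (neg T (\<Sigma>a\<^bsub>T\<^esub> u)) (Zero T (Cod T v') (\<Sigma>o\<^bsub>T\<^esub> (Cod T u)))
        (\<Sigma>a\<^bsub>T\<^esub> f)         w')"

definition good_completion ::
  "('o, 'm) suspended_cat \<Rightarrow> 'm triangle set \<Rightarrow> 'm square \<Rightarrow> 'm \<Rightarrow> bool" where
  "good_completion T \<Delta> q h \<longleftrightarrow> completion T q h \<and>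
     (cone_alpha T q, cone_beta T q h, cone_gamma T q) \<in> \<Delta>"

fun cone_beta0 :: "('o, 'm) suspended_cat \<Rightarrow> 'm square \<Rightarrow> 'm" where
  "cone_beta0 T ((u, v, w), (u', v', w'), f, g) =
     cone_beta T ((u, v, w), (u', v', w'), f, g) (Zero T (Cod T v) (Cod T v'))"

fun cone_J :: "('o, 'm) suspended_cat \<Rightarrow> 'm square \<Rightarrow> 'm set" where
  "cone_J T ((u, v, w), (u', v', w'), f, g) =
     (let q = ((u, v, w), (u', v', w'), f, g) in
      {block T (coneB T q) (coneC T q)
         (Zero T (Cod T v) (\<Sigma>o\<^bsub>T\<^esub> (Dom T u))) (Zero T (Cod T u') (\<Sigma>o\<^bsub>T\<^esub> (Dom T u)))
         a                                   (Zero T (Cod T u') (Cod T v'))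
       | a. a \<in> mor T (Cod T v) (Cod T v')})"

text \<open>
  In what follows \<open>e = (s, t)\<close> are the last two arrows of a distinguished triangle with first
  arrow \<open>\<alpha>\<close>.
\<close>

definition cone_choice ::
  "('o, 'm) suspended_cat \<Rightarrow> 'm triangle set \<Rightarrow> 'm square \<Rightarrow> 'm \<times> 'm \<Rightarrow> bool" where
  "cone_choice T \<Delta> q e \<longleftrightarrow> (cone_alpha T q, fst e, snd e) \<in> \<Delta>"

definition hom_BC :: "('o, 'm) suspended_cat \<Rightarrow> 'm square \<Rightarrow> 'm monoid" where
  "hom_BC T q = hom_group T (apex (coneB T q)) (apex (coneC T q))"

definition delta_dom :: "('o, 'm) suspended_cat \<Rightarrow> 'm square \<Rightarrow> 'm \<times> 'm \<Rightarrow> 'm monoid" where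
  "delta_dom T q e = hom_group T (Cod T (fst e)) (apex (coneC T q))"

definition delta_cod :: "('o, 'm) suspended_cat \<Rightarrow> 'm square \<Rightarrow> 'm \<times> 'm \<Rightarrow> ('m set \<times> 'm) monoid" where
  "delta_cod T q e =
     (hom_BC T q Mod cone_J T q) \<times>\<times> hom_group T (Cod T (fst e)) (\<Sigma>o\<^bsub>T\<^esub> (apex (coneA T q)))"

definition delta :: "('o, 'm) suspended_cat \<Rightarrow> 'm square \<Rightarrow> 'm \<times> 'm \<Rightarrow> 'm \<Rightarrow> 'm set \<times> 'm" where
  "delta T q e \<phi> = (cone_J T q #>\<^bsub>hom_BC T q\<^esub> (\<phi> \<cdot>\<^bsub>T\<^esub> fst e), cone_gamma T q \<cdot>\<^bsub>T\<^esub> \<phi>)"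

definition Obs :: "('o, 'm) suspended_cat \<Rightarrow> 'm square \<Rightarrow> 'm \<times> 'm \<Rightarrow> ('m set \<times> 'm) set monoid" where
  "Obs T q e = delta_cod T q e Mod (delta T q e ` carrier (delta_dom T q e))"

definition obstruction :: "('o, 'm) suspended_cat \<Rightarrow> 'm square \<Rightarrow> 'm \<times> 'm \<Rightarrow> ('m set \<times> 'm) set" where
  "obstruction T q e =
     (delta T q e ` carrier (delta_dom T q e)) #>\<^bsub>delta_cod T q e\<^esub>
       (cone_J T q #>\<^bsub>hom_BC T q\<^esub> cone_beta0 T q, snd e)"

definition comp_square ::
  "('o, 'm) suspended_cat \<Rightarrow> 'm triangle set \<Rightarrow> 'm \<Rightarrow> 'm \<Rightarrow> 'm square \<Rightarrow> bool" where
  "comp_square T \<Delta> g f q \<longleftrightarrow>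
     (\<exists>a b c d. (f, a, b) \<in> \<Delta> \<and> (g \<cdot>\<^bsub>T\<^esub> f, c, d) \<in> \<Delta> \<and>
        q = ((f, a, b), (g \<cdot>\<^bsub>T\<^esub> f, c, d), Idt T (Dom T f), g))"

end

theory Submission
  imports Defs
begin

text \<open>
  Vanishing of the obstruction says that there are a map \<open>\<phi> : E \<rightarrow> C\<close> and a map \<open>h\<close> with
  \<open>\<phi> s = \<beta>(h)\<close> and \<open>\<gamma> \<phi> = t\<close>. A good completion gives such a \<open>\<phi>\<close> by TR3. Conversely the two
  equations force \<open>\<beta>(h) \<alpha> = 0\<close> and \<open>\<gamma> \<beta>(h) = 0\<close>, that is, \<open>h\<close> is a completion; the cone of a
  morphism between distinguished triangles is exact under \<open>Hom(W, -)\<close>, so \<open>\<phi>\<close> is an isomorphism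
  by the five lemma.

  Given TR4, factor \<open>\<alpha>\<close> as \<open>Y \<oplus> X' \<rightarrow> Y \<oplus> Y' \<rightarrow> Z \<oplus> Y'\<close>, where the two maps have cones \<open>Z'\<close> and
  \<open>\<Sigma>X\<close>. In the octahedron the connecting map \<open>\<Sigma>X \<rightarrow> \<Sigma>Z'\<close> is \<open>\<plusminus>\<Sigma>(v' g u) = 0\<close>, so \<open>E\<close> splits as
  \<open>\<Sigma>X \<oplus> Z'\<close>, and the splitting can be corrected so that it yields \<open>\<phi>\<close>.

  Conversely, a good completion for \<open>q(g \<circ> f)\<close> has the homotopy cartesian triangle
  \<open>Y \<rightarrow> F \<oplus> Z \<rightarrow> H \<rightarrow> \<Sigma>Y\<close> as a retract of its cone, and retracts of distinguished triangles are
  distinguished. Applying this to \<open>Y \<rightarrow> Z\<close> factored through \<open>F \<oplus> Z\<close> and passing to a retract once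
  more produces the octahedron.
\<close>

section \<open>Arrow calculus in additive categories\<close>

locale additive =
  fixes T :: "('o, 'm, 'x) additive_cat_scheme" (structure)
  assumes additive: "additive_category T"
begin

abbreviation minus :: "'m \<Rightarrow> 'm" ("\<ominus> _" [81] 80) where
  "\<ominus> f \<equiv> neg T f"

lemma cat: "category T"
  using additive by (simp add: additive_category_def)

lemma dom_obj [simp]: "f \<in> Arr T \<Longrightarrow> Dom T f \<in> Obj T"
  and cod_obj [simp]: "f \<in> Arr T \<Longrightarrow> Cod T f \<in> Obj T"
  using cat by (auto simp: category_def)

lemma morI: "f \<in> Arr T \<Longrightarrow> f \<in> mor T (Dom T f) (Cod T f)"
  by (simp add: mor_def)

lemma idt_mor: "X \<in> Obj T \<Longrightarrow> Idt T X \<in> mor T X X"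
  using cat by (simp add: category_def)

lemma idt [simp]: "X \<in> Obj T \<Longrightarrow> Idt T X \<in> Arr T"
  "X \<in> Obj T \<Longrightarrow> Dom T (Idt T X) = X" "X \<in> Obj T \<Longrightarrow> Cod T (Idt T X) = X"
  using idt_mor by (auto simp: mor_def)

lemma comp_mor: "f \<in> mor T X Y \<Longrightarrow> g \<in> mor T Y Z \<Longrightarrow> g \<cdot> f \<in> mor T X Z"
  using cat unfolding category_def by blast

text \<open>Typing is phrased through \<open>Arr\<close>, \<open>Dom\<close> and \<open>Cod\<close>
  rather than through \<open>mor\<close>: the endpoints of a composite are then computed by
  rewriting, and no objects have to be guessed.\<close>

lemma comp [simp]:
  assumes "f \<in> Arr T" "g \<in> Arr T" "Dom T g = Cod T f"
  shows "g \<cdot> f \<in> Arr T" "Dom T (g \<cdot> f) = Dom T f" "Cod T (g \<cdot> f) = Cod T g"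
  using comp_mor[of f "Dom T f" "Cod T f" g "Cod T g"] assms by (auto simp: mor_def)

lemma comp_idt [simp]: "f \<in> Arr T \<Longrightarrow> Dom T f = X \<Longrightarrow> f \<cdot> Idt T X = f"
  and idt_comp [simp]: "f \<in> Arr T \<Longrightarrow> Cod T f = X \<Longrightarrow> Idt T X \<cdot> f = f"
  using cat morI unfolding category_def by blast+

lemma comp_assoc [simp]:
  assumes "f \<in> Arr T" "g \<in> Arr T" "h \<in> Arr T" "Dom T g = Cod T f" "Dom T h = Cod T g"
  shows "(h \<cdot> g) \<cdot> f = h \<cdot> (g \<cdot> f)"
  using cat assms unfolding category_def by (metis morI)

text \<open>The simplifier associates composites to the right, so an equation for
  \<open>h \<cdot> g\<close> no longer matches once something is composed on the right. Applied to
  such an equation, this rule makes it usable inside longer composites.\<close>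

lemma comp_reassoc:
  assumes "h \<cdot> g = k" "f \<in> Arr T" "g \<in> Arr T" "h \<in> Arr T" "Dom T g = Cod T f" "Dom T h = Cod T g"
  shows "h \<cdot> (g \<cdot> f) = k \<cdot> f"
  using comp_assoc[of f g h] assms by simp

section \<open>The groups of arrows\<close>

lemma hom_comm_group: "X \<in> Obj T \<Longrightarrow> Y \<in> Obj T \<Longrightarrow> comm_group (hom_group T X Y)"
  using additive by (simp add: additive_category_def)

lemma hom_group_simps:
  "carrier (hom_group T X Y) = mor T X Y" "monoid.mult (hom_group T X Y) = Add T"
  "one (hom_group T X Y) = Zero T X Y"
  by (simp_all add: hom_group_def)

context
  fixes X Y assumes XY: "X \<in> Obj T" "Y \<in> Obj T"
begin

interpretation H: comm_group "hom_group T X Y"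
  using XY by (rule hom_comm_group)

lemma zero_mor: "Zero T X Y \<in> mor T X Y"
  using H.one_closed by (simp add: hom_group_simps)

lemma add_mor: "f \<in> mor T X Y \<Longrightarrow> g \<in> mor T X Y \<Longrightarrow> f \<boxplus> g \<in> mor T X Y"
  using H.m_closed by (simp add: hom_group_simps)

lemma neg_eq: "f \<in> mor T X Y \<Longrightarrow> \<ominus> f = inv\<^bsub>hom_group T X Y\<^esub> f"
  by (auto simp: neg_def mor_def)

lemma neg_mor: "f \<in> mor T X Y \<Longrightarrow> \<ominus> f \<in> mor T X Y"
  using H.inv_closed by (simp add: neg_eq hom_group_simps)

text \<open>Everything is inherited from the abelian group \<open>hom_group T X Y\<close>;
  \<open>neg_eq\<close> is the bridge to \<open>neg\<close>, which reads its group off the endpoints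
  of its argument.\<close>

lemma add_group_laws:
  assumes "f \<in> mor T X Y" "g \<in> mor T X Y" "h \<in> mor T X Y"
  shows "(f \<boxplus> g) \<boxplus> h = f \<boxplus> (g \<boxplus> h)" "f \<boxplus> g = g \<boxplus> f" "f \<boxplus> (g \<boxplus> h) = g \<boxplus> (f \<boxplus> h)"
    "Zero T X Y \<boxplus> f = f" "f \<boxplus> Zero T X Y = f"
    "f \<boxplus> \<ominus> f = Zero T X Y" "\<ominus> f \<boxplus> f = Zero T X Y"
    "f \<boxplus> (\<ominus> f \<boxplus> g) = g" "\<ominus> f \<boxplus> (f \<boxplus> g) = g"
    "\<ominus> (f \<boxplus> g) = \<ominus> f \<boxplus> \<ominus> g" "\<ominus> (\<ominus> f) = f" "\<ominus> (Zero T X Y) = Zero T X Y"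
    "f \<boxplus> g = f \<boxplus> h \<longleftrightarrow> g = h"
proof -
  note c = assms[folded hom_group_simps(1)[of X Y]]
  have n: "\<ominus> k = inv\<^bsub>hom_group T X Y\<^esub> k" if "k \<in> carrier (hom_group T X Y)" for k
    using that neg_eq by (simp add: hom_group_simps)
  note m = hom_group_simps(2)[of X Y, symmetric] hom_group_simps(3)[of X Y, symmetric]
  show "(f \<boxplus> g) \<boxplus> h = f \<boxplus> (g \<boxplus> h)" unfolding m using c by (rule H.m_assoc)
  show "f \<boxplus> g = g \<boxplus> f" unfolding m using c(1,2) by (rule H.m_comm)
  show "f \<boxplus> (g \<boxplus> h) = g \<boxplus> (f \<boxplus> h)" unfolding m using c by (rule H.m_lcomm)
  show "Zero T X Y \<boxplus> f = f" unfolding m using c by simp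
  show "f \<boxplus> Zero T X Y = f" unfolding m using c by simp
  show "f \<boxplus> \<ominus> f = Zero T X Y" unfolding m n[OF c(1)] using c by simp
  show "\<ominus> f \<boxplus> f = Zero T X Y" unfolding m n[OF c(1)] using c by simp
  show "f \<boxplus> (\<ominus> f \<boxplus> g) = g" unfolding m n[OF c(1)] using c by (simp add: H.m_assoc[symmetric])
  show "\<ominus> f \<boxplus> (f \<boxplus> g) = g" unfolding m n[OF c(1)] using c by (simp add: H.m_assoc[symmetric])
  show "\<ominus> (f \<boxplus> g) = \<ominus> f \<boxplus> \<ominus> g"
    unfolding m using c by (simp add: n H.inv_mult)
  show "\<ominus> (\<ominus> f) = f" using c by (simp add: n)
  show "\<ominus> (Zero T X Y) = Zero T X Y" unfolding m using c by (simp add: n)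
  show "f \<boxplus> g = f \<boxplus> h \<longleftrightarrow> g = h" unfolding m using c by simp
qed

end

lemma zero [simp]:
  assumes "X \<in> Obj T" "Y \<in> Obj T"
  shows "Zero T X Y \<in> Arr T" "Dom T (Zero T X Y) = X" "Cod T (Zero T X Y) = Y"
  using zero_mor[OF assms] by (auto simp: mor_def)

lemma neg [simp]:
  assumes "f \<in> Arr T"
  shows "\<ominus> f \<in> Arr T" "Dom T (\<ominus> f) = Dom T f" "Cod T (\<ominus> f) = Cod T f"
  using neg_mor[OF _ _ morI[OF assms]] assms by (auto simp: mor_def)

lemma add [simp]:
  assumes "f \<in> Arr T" "g \<in> Arr T" "Dom T g = Dom T f" "Cod T g = Cod T f"
  shows "f \<boxplus> g \<in> Arr T" "Dom T (f \<boxplus> g) = Dom T f" "Cod T (f \<boxplus> g) = Cod T f"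
  using add_mor[OF _ _ morI[OF assms(1)], of g] assms by (auto simp: mor_def)

lemma add_zero [simp]:
  assumes "f \<in> Arr T" "Dom T f = X" "Cod T f = Y"
  shows "Zero T X Y \<boxplus> f = f" "f \<boxplus> Zero T X Y = f"
  using add_group_laws(4,5)[of X Y f f f] assms by (auto simp: mor_def)

lemma add_neg [simp]:
  assumes "f \<in> Arr T"
  shows "f \<boxplus> \<ominus> f = Zero T (Dom T f) (Cod T f)" "\<ominus> f \<boxplus> f = Zero T (Dom T f) (Cod T f)"
  using add_group_laws(6,7)[of "Dom T f" "Cod T f" f f f] assms by (auto simp: mor_def)

lemma neg_neg [simp]: "f \<in> Arr T \<Longrightarrow> \<ominus> (\<ominus> f) = f"
  using add_group_laws(11)[of "Dom T f" "Cod T f" f f f] by (auto simp: mor_def)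

lemma neg_zero [simp]: "X \<in> Obj T \<Longrightarrow> Y \<in> Obj T \<Longrightarrow> \<ominus> (Zero T X Y) = Zero T X Y"
  using add_group_laws(12)[of X Y] zero_mor by metis

lemma add_neg_cancel [simp]:
  assumes "f \<in> Arr T" "g \<in> Arr T" "Dom T g = Dom T f" "Cod T g = Cod T f"
  shows "f \<boxplus> (\<ominus> f \<boxplus> g) = g" "\<ominus> f \<boxplus> (f \<boxplus> g) = g"
  using add_group_laws(8,9)[of "Dom T f" "Cod T f" f g g] assms by (auto simp: mor_def)

lemma neg_add [simp]:
  assumes "f \<in> Arr T" "g \<in> Arr T" "Dom T g = Dom T f" "Cod T g = Cod T f"
  shows "\<ominus> (f \<boxplus> g) = \<ominus> f \<boxplus> \<ominus> g"
  using add_group_laws(10)[of "Dom T f" "Cod T f" f g g] assms by (auto simp: mor_def)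

lemma add_ac:
  assumes "f \<in> Arr T" "g \<in> Arr T" "Dom T g = Dom T f" "Cod T g = Cod T f"
  shows "f \<boxplus> g = g \<boxplus> f"
    "h \<in> Arr T \<Longrightarrow> Dom T h = Dom T f \<Longrightarrow> Cod T h = Cod T f \<Longrightarrow> (f \<boxplus> g) \<boxplus> h = f \<boxplus> (g \<boxplus> h)"
    "h \<in> Arr T \<Longrightarrow> Dom T h = Dom T f \<Longrightarrow> Cod T h = Cod T f \<Longrightarrow> f \<boxplus> (g \<boxplus> h) = g \<boxplus> (f \<boxplus> h)"
  using add_group_laws(1-3)[of "Dom T f" "Cod T f" f g h]
    add_group_laws(1-3)[of "Dom T f" "Cod T f" f g g] assms by (auto simp: mor_def)

lemma add_cancel_outer [simp]:
  assumes "f \<in> Arr T" "g \<in> Arr T" "Dom T g = Dom T f" "Cod T g = Cod T f"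
  shows "f \<boxplus> (g \<boxplus> \<ominus> f) = g" "\<ominus> f \<boxplus> (g \<boxplus> f) = g"
  using assms add_ac(1)[of g f] add_ac(1)[of g "\<ominus> f"] by simp_all

lemma add_left_cancel:
  assumes "f \<in> Arr T" "g \<in> Arr T" "h \<in> Arr T"
    "Dom T g = Dom T f" "Cod T g = Cod T f" "Dom T h = Dom T f" "Cod T h = Cod T f"
  shows "f \<boxplus> g = f \<boxplus> h \<longleftrightarrow> g = h"
  using add_group_laws(13)[of "Dom T f" "Cod T f" f g h] assms by (auto simp: mor_def)

lemma comp_add [simp]:
  assumes "f \<in> Arr T" "g \<in> Arr T" "Dom T g = Dom T f" "Cod T g = Cod T f"
  shows "h \<in> Arr T \<Longrightarrow> Dom T h = Cod T f \<Longrightarrow> h \<cdot> (f \<boxplus> g) = (h \<cdot> f) \<boxplus> (h \<cdot> g)"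
    "k \<in> Arr T \<Longrightarrow> Cod T k = Dom T f \<Longrightarrow> (f \<boxplus> g) \<cdot> k = (f \<cdot> k) \<boxplus> (g \<cdot> k)"
proof -
  have *: "\<And>X Y Z f f' g g'. f\<in>mor T X Y \<Longrightarrow> f'\<in>mor T X Y \<Longrightarrow> g\<in>mor T Y Z \<Longrightarrow> g'\<in>mor T Y Z \<Longrightarrow>
        g \<cdot> (f \<boxplus> f') = (g \<cdot> f) \<boxplus> (g \<cdot> f') \<and> (g \<boxplus> g') \<cdot> f = (g \<cdot> f) \<boxplus> (g' \<cdot> f)"
    using additive unfolding additive_category_def by blast
  show "h \<in> Arr T \<Longrightarrow> Dom T h = Cod T f \<Longrightarrow> h \<cdot> (f \<boxplus> g) = (h \<cdot> f) \<boxplus> (h \<cdot> g)"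
    using *[of f "Dom T f" "Cod T f" g h "Cod T h" h] assms by (simp add: mor_def)
  show "k \<in> Arr T \<Longrightarrow> Cod T k = Dom T f \<Longrightarrow> (f \<boxplus> g) \<cdot> k = (f \<cdot> k) \<boxplus> (g \<cdot> k)"
    using *[of k "Dom T k" "Cod T k" k f "Cod T f" g] assms by (simp add: mor_def)
qed

text \<open>A group has only one idempotent. This is how additivity of composition and of \<Sigma>
  yields that they preserve zero arrows.\<close>

lemma add_self_zero:
  assumes "f \<in> Arr T" "f \<boxplus> f = f" shows "f = Zero T (Dom T f) (Cod T f)"
  using add_left_cancel[of f f "Zero T (Dom T f) (Cod T f)"] assms by simp

lemma comp_zero [simp]:
  assumes "f \<in> Arr T" "X \<in> Obj T"
  shows "Dom T f = Y \<Longrightarrow> f \<cdot> Zero T X Y = Zero T X (Cod T f)"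
    "Cod T f = Y \<Longrightarrow> Zero T Y X \<cdot> f = Zero T (Dom T f) X"
proof -
  show "f \<cdot> Zero T X Y = Zero T X (Cod T f)" if "Dom T f = Y"
    using add_self_zero[of "f \<cdot> Zero T X Y"] comp_add(1)[of "Zero T X Y" "Zero T X Y" f] assms that
    by (auto simp del: comp_add)
  show "Zero T Y X \<cdot> f = Zero T (Dom T f) X" if "Cod T f = Y"
    using add_self_zero[of "Zero T Y X \<cdot> f"] comp_add(2)[of "Zero T Y X" "Zero T Y X" f] assms that
    by (auto simp del: comp_add)
qed

lemma neg_unique:
  assumes "f \<in> Arr T" "g \<in> Arr T" "Dom T g = Dom T f" "Cod T g = Cod T f"
    "f \<boxplus> g = Zero T (Dom T f) (Cod T f)"
  shows "g = \<ominus> f"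
  using add_left_cancel[of f g "\<ominus> f"] assms by simp

lemma comp_neg [simp]:
  assumes "f \<in> Arr T" "g \<in> Arr T" "Dom T g = Cod T f"
  shows "g \<cdot> \<ominus> f = \<ominus> (g \<cdot> f)" "\<ominus> g \<cdot> f = \<ominus> (g \<cdot> f)"
proof -
  have "(g \<cdot> f) \<boxplus> (g \<cdot> \<ominus> f) = g \<cdot> (f \<boxplus> \<ominus> f)"
    using assms by (subst comp_add) auto
  then show "g \<cdot> \<ominus> f = \<ominus> (g \<cdot> f)"
    using assms by (intro neg_unique) (simp_all del: comp_add)
  have "(g \<cdot> f) \<boxplus> (\<ominus> g \<cdot> f) = (g \<boxplus> \<ominus> g) \<cdot> f"
    using assms by (subst comp_add) auto
  then show "\<ominus> g \<cdot> f = \<ominus> (g \<cdot> f)"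
    using assms by (intro neg_unique) (simp_all del: comp_add)
qed

lemma neg_eq_zero [simp]:
  assumes "f \<in> Arr T" "X = Dom T f" "Y = Cod T f"
  shows "\<ominus> f = Zero T X Y \<longleftrightarrow> f = Zero T X Y"
  using assms neg_neg neg_zero by (metis cod_obj dom_obj)

lemma neg_inject:
  assumes "f \<in> Arr T" "g \<in> Arr T"
  shows "\<ominus> f = \<ominus> g \<longleftrightarrow> f = g"
  using assms neg_neg by metis

lemma add_eq_zero_iff:
  assumes "f \<in> Arr T" "g \<in> Arr T" "Dom T g = Dom T f" "Cod T g = Cod T f"
    "X = Dom T f" "Y = Cod T f"
  shows "f \<boxplus> g = Zero T X Y \<longleftrightarrow> g = \<ominus> f"
  using assms neg_unique by auto

section \<open>Biproducts\<close>

lemma bip: "X \<in> Obj T \<Longrightarrow> Y \<in> Obj T \<Longrightarrow> is_biproduct T X Y (Bip T X Y)"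
  using additive by (simp add: additive_category_def)

lemma bip_arr [simp]:
  assumes "X \<in> Obj T" "Y \<in> Obj T"
  shows "apex (Bip T X Y) \<in> Obj T"
    "inj1 (Bip T X Y) \<in> Arr T" "inj2 (Bip T X Y) \<in> Arr T"
    "prj1 (Bip T X Y) \<in> Arr T" "prj2 (Bip T X Y) \<in> Arr T"
    "Dom T (inj1 (Bip T X Y)) = X" "Dom T (inj2 (Bip T X Y)) = Y"
    "Cod T (inj1 (Bip T X Y)) = apex (Bip T X Y)" "Cod T (inj2 (Bip T X Y)) = apex (Bip T X Y)"
    "Dom T (prj1 (Bip T X Y)) = apex (Bip T X Y)" "Dom T (prj2 (Bip T X Y)) = apex (Bip T X Y)"
    "Cod T (prj1 (Bip T X Y)) = X" "Cod T (prj2 (Bip T X Y)) = Y"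
    "prj1 (Bip T X Y) \<cdot> inj1 (Bip T X Y) = Idt T X"
    "prj2 (Bip T X Y) \<cdot> inj2 (Bip T X Y) = Idt T Y"
    "prj2 (Bip T X Y) \<cdot> inj1 (Bip T X Y) = Zero T X Y"
    "prj1 (Bip T X Y) \<cdot> inj2 (Bip T X Y) = Zero T Y X"
  using bip[OF assms] by (auto simp: is_biproduct_def mor_def)

lemma bip_comp [simp]:
  assumes "X \<in> Obj T" "Y \<in> Obj T" "f \<in> Arr T"
  shows "Cod T f = X \<Longrightarrow> prj1 (Bip T X Y) \<cdot> (inj1 (Bip T X Y) \<cdot> f) = f"
    "Cod T f = Y \<Longrightarrow> prj2 (Bip T X Y) \<cdot> (inj2 (Bip T X Y) \<cdot> f) = f"
    "Cod T f = X \<Longrightarrow> prj2 (Bip T X Y) \<cdot> (inj1 (Bip T X Y) \<cdot> f) = Zero T (Dom T f) Y"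
    "Cod T f = Y \<Longrightarrow> prj1 (Bip T X Y) \<cdot> (inj2 (Bip T X Y) \<cdot> f) = Zero T (Dom T f) X"
  using assms comp_assoc[of f "inj1 (Bip T X Y)" "prj1 (Bip T X Y)"]
    comp_assoc[of f "inj2 (Bip T X Y)" "prj1 (Bip T X Y)"]
    comp_assoc[of f "inj1 (Bip T X Y)" "prj2 (Bip T X Y)"]
    comp_assoc[of f "inj2 (Bip T X Y)" "prj2 (Bip T X Y)"]
  by (simp_all del: comp_assoc)

text \<open>Expanding the identity of the apex into its two summands recovers an arrow from its
  components. \<open>P\<close> is arbitrary because the rule is also needed for
  \<open>susp_bip\<close>, which need not be a chosen biproduct.\<close>

lemma biproduct_into_eqI:
  assumes P: "is_biproduct T X Y P" and f: "f \<in> Arr T" "Cod T f = apex P"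
    and g: "g \<in> Arr T" "Cod T g = apex P" and fg: "Dom T f = Dom T g"
    and eq: "prj1 P \<cdot> f = prj1 P \<cdot> g" "prj2 P \<cdot> f = prj2 P \<cdot> g"
  shows "f = g"
proof -
  have *: "k = (inj1 P \<cdot> (prj1 P \<cdot> k)) \<boxplus> (inj2 P \<cdot> (prj2 P \<cdot> k))"
    if "k \<in> Arr T" "Cod T k = apex P" for k
  proof -
    have "k = ((inj1 P \<cdot> prj1 P) \<boxplus> (inj2 P \<cdot> prj2 P)) \<cdot> k"
      using that P by (simp add: is_biproduct_def)
    also have "\<dots> = (inj1 P \<cdot> (prj1 P \<cdot> k)) \<boxplus> (inj2 P \<cdot> (prj2 P \<cdot> k))"
      using that P by (subst comp_add) (auto simp: is_biproduct_def mor_def)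
    finally show ?thesis .
  qed
  show ?thesis using *[OF f] *[OF g] eq by simp
qed

lemma biproduct_from_eqI:
  assumes P: "is_biproduct T X Y P" and f: "f \<in> Arr T" "Dom T f = apex P"
    and g: "g \<in> Arr T" "Dom T g = apex P" and fg: "Cod T f = Cod T g"
    and eq: "f \<cdot> inj1 P = g \<cdot> inj1 P" "f \<cdot> inj2 P = g \<cdot> inj2 P"
  shows "f = g"
proof -
  have *: "k = ((k \<cdot> inj1 P) \<cdot> prj1 P) \<boxplus> ((k \<cdot> inj2 P) \<cdot> prj2 P)"
    if "k \<in> Arr T" "Dom T k = apex P" for k
  proof -
    have "k = k \<cdot> ((inj1 P \<cdot> prj1 P) \<boxplus> (inj2 P \<cdot> prj2 P))"
      using that P by (simp add: is_biproduct_def)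
    also have "\<dots> = ((k \<cdot> inj1 P) \<cdot> prj1 P) \<boxplus> ((k \<cdot> inj2 P) \<cdot> prj2 P)"
      using that P by (subst comp_add) (auto simp: is_biproduct_def mor_def)
    finally show ?thesis .
  qed
  show ?thesis using *[OF f] *[OF g] eq by simp
qed

lemmas bip_into_eqI = biproduct_into_eqI[OF bip] and bip_from_eqI = biproduct_from_eqI[OF bip]

end

section \<open>Exactness under Hom(W, -)\<close>

context additive
begin

text \<open>Only the inclusion of the kernel in the image is recorded, for all sources W at once.
  The vanishing of the composite is left to the conditions on a candidate triangle.\<close>

definition hom_exact :: "'m \<Rightarrow> 'm \<Rightarrow> bool" where
  "hom_exact u v \<longleftrightarrow> (\<forall>y\<in>Arr T. Cod T y = Cod T u \<longrightarrow> v \<cdot> y = Zero T (Dom T y) (Cod T v) \<longrightarrow>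
     (\<exists>x\<in>Arr T. Dom T x = Dom T y \<and> Cod T x = Dom T u \<and> u \<cdot> x = y))"

lemma hom_exactI:
  assumes "\<And>y. y \<in> Arr T \<Longrightarrow> Cod T y = Cod T u \<Longrightarrow> v \<cdot> y = Zero T (Dom T y) (Cod T v) \<Longrightarrow>
     \<exists>x\<in>Arr T. Dom T x = Dom T y \<and> Cod T x = Dom T u \<and> u \<cdot> x = y"
  shows "hom_exact u v"
  using assms by (auto simp: hom_exact_def)

lemma hom_exactE:
  assumes "hom_exact u v" "y \<in> Arr T" "Cod T y = Cod T u" "v \<cdot> y = Zero T (Dom T y) (Cod T v)"
  obtains x where "x \<in> Arr T" "Dom T x = Dom T y" "Cod T x = Dom T u" "u \<cdot> x = y"
  using assms by (auto simp: hom_exact_def)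

end

section \<open>Pre-triangulated categories\<close>

locale suspended = additive T for T :: "('o, 'm) suspended_cat" (structure) +
  assumes suspended: "suspended_category T"
begin

lemma susp_functor: "is_functor T T (Susp T)"
  using suspended by (simp add: suspended_category_def cat_equivalence_def)

lemma susp_obj [simp]: "X \<in> Obj T \<Longrightarrow> \<Sigma>o X \<in> Obj T"
  using susp_functor by (simp add: is_functor_def)

lemma susp_arr [simp]:
  assumes "f \<in> Arr T"
  shows "\<Sigma>a f \<in> Arr T" "Dom T (\<Sigma>a f) = \<Sigma>o (Dom T f)" "Cod T (\<Sigma>a f) = \<Sigma>o (Cod T f)"
proof -
  have "\<Sigma>a f \<in> mor T (\<Sigma>o (Dom T f)) (\<Sigma>o (Cod T f))"
    using susp_functor morI[OF assms] unfolding is_functor_def by blast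
  then show "\<Sigma>a f \<in> Arr T" "Dom T (\<Sigma>a f) = \<Sigma>o (Dom T f)" "Cod T (\<Sigma>a f) = \<Sigma>o (Cod T f)"
    by (auto simp: mor_def)
qed

lemma susp_idt [simp]: "X \<in> Obj T \<Longrightarrow> \<Sigma>a (Idt T X) = Idt T (\<Sigma>o X)"
  using susp_functor by (simp add: is_functor_def)

lemma susp_comp [simp]:
  assumes "f \<in> Arr T" "g \<in> Arr T" "Dom T g = Cod T f"
  shows "\<Sigma>a (g \<cdot> f) = \<Sigma>a g \<cdot> \<Sigma>a f"
  using susp_functor morI assms unfolding is_functor_def by metis

lemma susp_add [simp]:
  assumes "f \<in> Arr T" "g \<in> Arr T" "Dom T g = Dom T f" "Cod T g = Cod T f"
  shows "\<Sigma>a (f \<boxplus> g) = \<Sigma>a f \<boxplus> \<Sigma>a g"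
  using suspended morI assms unfolding suspended_category_def by metis

lemma susp_zero [simp]:
  assumes "X \<in> Obj T" "Y \<in> Obj T"
  shows "\<Sigma>a (Zero T X Y) = Zero T (\<Sigma>o X) (\<Sigma>o Y)"
  using susp_add[of "Zero T X Y" "Zero T X Y"] add_self_zero[of "\<Sigma>a (Zero T X Y)"] assms by simp

lemma susp_neg [simp]:
  assumes "f \<in> Arr T"
  shows "\<Sigma>a (\<ominus> f) = \<ominus> (\<Sigma>a f)"
  using susp_add[of f "\<ominus> f"] assms by (intro neg_unique) simp_all

text \<open>The unit makes \<Sigma> faithful and the counit makes its quasi-inverse \<open>G\<close>
  faithful; faithfulness of \<open>G\<close> then gives fullness of \<Sigma>. Arrows between
  suspensions can thus be desuspended although \<Sigma> has only a quasi-inverse.\<close>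

lemma
  shows susp_faithful: "\<lbrakk>f \<in> mor T X Y; g \<in> mor T X Y; \<Sigma>a f = \<Sigma>a g\<rbrakk> \<Longrightarrow> f = g"
    and susp_full: "\<lbrakk>X \<in> Obj T; Y \<in> Obj T; h \<in> mor T (\<Sigma>o X) (\<Sigma>o Y)\<rbrakk> \<Longrightarrow> \<exists>f\<in>mor T X Y. \<Sigma>a f = h"
proof -
  obtain G \<eta> \<epsilon> where G: "is_functor T T G"
    and \<eta>: "natural_iso T T functor_id (functor_comp G (Susp T)) \<eta>"
    and \<epsilon>: "natural_iso T T (functor_comp (Susp T) G) functor_id \<epsilon>"
    using suspended unfolding suspended_category_def cat_equivalence_def by blast
  have iso: "iso_arrow T (\<eta> X)" "\<eta> X \<in> mor T X (omap G (\<Sigma>o X))"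
    "iso_arrow T (\<epsilon> X)" "\<epsilon> X \<in> mor T (\<Sigma>o (omap G X)) X" if "X \<in> Obj T" for X
    using \<eta> \<epsilon> that by (auto simp: natural_iso_def functor_id_def functor_comp_def)
  have nat: "\<eta> Y \<cdot> f = amap G (\<Sigma>a f) \<cdot> \<eta> X" "\<epsilon> Y \<cdot> \<Sigma>a (amap G f) = f \<cdot> \<epsilon> X"
    if "f \<in> mor T X Y" for f X Y
    using \<eta> \<epsilon> that by (auto simp: natural_iso_def functor_id_def functor_comp_def)
  have Gmor: "amap G f \<in> mor T (omap G X) (omap G Y)" if "f \<in> mor T X Y" for f X Y
    using G that unfolding is_functor_def by blast
  have inv: "\<exists>e'\<in>mor T Y X. e' \<cdot> e = Idt T X \<and> e \<cdot> e' = Idt T Y"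
    if "iso_arrow T e" "e \<in> mor T X Y" for e X Y
    using that by (auto simp: iso_arrow_def mor_def)
  have obj: "X \<in> Obj T" "Y \<in> Obj T" if "f \<in> mor T X Y" for f X Y
    using that by (auto simp: mor_def)
  have Sfaith: "f = g" if f: "f \<in> mor T X Y" and g: "g \<in> mor T X Y" and eq: "\<Sigma>a f = \<Sigma>a g" for f g X Y
  proof -
    obtain e where e: "e \<in> mor T (omap G (\<Sigma>o Y)) Y" "e \<cdot> \<eta> Y = Idt T Y"
      using inv[OF iso(1,2)] obj[OF f] by blast
    have "\<eta> Y \<cdot> f = \<eta> Y \<cdot> g" using nat(1)[OF f] nat(1)[OF g] eq by simp
    then have "e \<cdot> (\<eta> Y \<cdot> f) = e \<cdot> (\<eta> Y \<cdot> g)" by simp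
    then show ?thesis
      using comp_reassoc[OF e(2), of f] comp_reassoc[OF e(2), of g] e iso(2)[of Y] obj[OF f] f g
      by (simp add: mor_def)
  qed
  have Gfaith: "f = g" if f: "f \<in> mor T X Y" and g: "g \<in> mor T X Y" and eq: "amap G f = amap G g" for f g X Y
  proof -
    obtain e where e: "e \<in> mor T X (\<Sigma>o (omap G X))" "\<epsilon> X \<cdot> e = Idt T X"
      using inv[OF iso(3,4)] obj[OF f] by blast
    have "f \<cdot> \<epsilon> X = g \<cdot> \<epsilon> X" using nat(2)[OF f] nat(2)[OF g] eq by simp
    then have "(f \<cdot> \<epsilon> X) \<cdot> e = (g \<cdot> \<epsilon> X) \<cdot> e" by simp
    then show ?thesis
      using e iso(4)[of X] obj[OF f] f g by (simp add: mor_def)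
  qed
  show "\<lbrakk>f \<in> mor T X Y; g \<in> mor T X Y; \<Sigma>a f = \<Sigma>a g\<rbrakk> \<Longrightarrow> f = g" by (rule Sfaith)
  show "\<exists>f\<in>mor T X Y. \<Sigma>a f = h" if X: "X \<in> Obj T" and Y: "Y \<in> Obj T" and h: "h \<in> mor T (\<Sigma>o X) (\<Sigma>o Y)"
  proof -
    obtain e where e: "e \<in> mor T (omap G (\<Sigma>o Y)) Y" "\<eta> Y \<cdot> e = Idt T (omap G (\<Sigma>o Y))"
      using inv[OF iso(1,2)[OF Y]] by blast
    obtain d where d: "d \<in> mor T (omap G (\<Sigma>o X)) X" "\<eta> X \<cdot> d = Idt T (omap G (\<Sigma>o X))"
      using inv[OF iso(1,2)[OF X]] by blast
    \<comment> \<open>Naturality of \<open>\<eta>\<close> forces this preimage: it is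
      \<open>G\<close> of \<open>h\<close>, conjugated by the unit. Applying \<open>G\<close> to
      \<open>\<Sigma>a f\<close> and to \<open>h\<close> then gives the same arrow.\<close>
    define f where "f = e \<cdot> (amap G h \<cdot> \<eta> X)"
    note tp = e(1) d(1) Gmor[OF h] iso(2)[OF X] iso(2)[OF Y] h X Y
    have f: "f \<in> mor T X Y" using tp by (simp add: f_def mor_def)
    have "\<eta> Y \<cdot> f = amap G h \<cdot> \<eta> X"
      using tp by (simp add: f_def mor_def comp_reassoc[OF e(2)])
    then have "amap G (\<Sigma>a f) \<cdot> \<eta> X = amap G h \<cdot> \<eta> X" using nat(1)[OF f] by simp
    then have "(amap G (\<Sigma>a f) \<cdot> \<eta> X) \<cdot> d = (amap G h \<cdot> \<eta> X) \<cdot> d" by simp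
    moreover have Sf: "\<Sigma>a f \<in> mor T (\<Sigma>o X) (\<Sigma>o Y)" using f by (simp add: mor_def)
    ultimately have "amap G (\<Sigma>a f) = amap G h"
      using tp Gmor[OF Sf] d(2) by (simp add: mor_def)
    then show ?thesis using Gfaith[OF Sf h] f by blast
  qed
qed

lemma is_biproduct_susp_bip:
  assumes "X \<in> Obj T" "Y \<in> Obj T"
  shows "is_biproduct T (\<Sigma>o X) (\<Sigma>o Y) (susp_bip T (Bip T X Y))"
proof -
  let ?P = "Bip T X Y"
  note s = susp_comp[of "inj1 ?P" "prj1 ?P"] susp_comp[of "inj2 ?P" "prj2 ?P"]
    susp_comp[of "inj1 ?P" "prj2 ?P"] susp_comp[of "inj2 ?P" "prj1 ?P"]
  have "(inj1 ?P \<cdot> prj1 ?P) \<boxplus> (inj2 ?P \<cdot> prj2 ?P) = Idt T (apex ?P)"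
    using bip[OF assms] by (simp add: is_biproduct_def)
  from arg_cong[OF this, of "\<Sigma>a"] show ?thesis
    using assms s by (simp add: is_biproduct_def susp_bip_def mor_def)
qed

lemma susp_bip_comp [simp]:
  assumes "X \<in> Obj T" "Y \<in> Obj T"
  shows "\<Sigma>a (prj1 (Bip T X Y)) \<cdot> \<Sigma>a (inj1 (Bip T X Y)) = Idt T (\<Sigma>o X)"
    "\<Sigma>a (prj2 (Bip T X Y)) \<cdot> \<Sigma>a (inj2 (Bip T X Y)) = Idt T (\<Sigma>o Y)"
    "\<Sigma>a (prj2 (Bip T X Y)) \<cdot> \<Sigma>a (inj1 (Bip T X Y)) = Zero T (\<Sigma>o X) (\<Sigma>o Y)"
    "\<Sigma>a (prj1 (Bip T X Y)) \<cdot> \<Sigma>a (inj2 (Bip T X Y)) = Zero T (\<Sigma>o Y) (\<Sigma>o X)"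
  using is_biproduct_susp_bip[OF assms] by (auto simp: is_biproduct_def susp_bip_def)

lemma susp_bip_comp' [simp]:
  assumes "X \<in> Obj T" "Y \<in> Obj T" "f \<in> Arr T"
  shows "Cod T f = \<Sigma>o X \<Longrightarrow> \<Sigma>a (prj1 (Bip T X Y)) \<cdot> (\<Sigma>a (inj1 (Bip T X Y)) \<cdot> f) = f"
    "Cod T f = \<Sigma>o Y \<Longrightarrow> \<Sigma>a (prj2 (Bip T X Y)) \<cdot> (\<Sigma>a (inj2 (Bip T X Y)) \<cdot> f) = f"
    "Cod T f = \<Sigma>o X \<Longrightarrow> \<Sigma>a (prj2 (Bip T X Y)) \<cdot> (\<Sigma>a (inj1 (Bip T X Y)) \<cdot> f) = Zero T (Dom T f) (\<Sigma>o Y)"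
    "Cod T f = \<Sigma>o Y \<Longrightarrow> \<Sigma>a (prj1 (Bip T X Y)) \<cdot> (\<Sigma>a (inj2 (Bip T X Y)) \<cdot> f) = Zero T (Dom T f) (\<Sigma>o X)"
  using assms by (simp_all add: susp_bip_comp[THEN comp_reassoc])

lemmas susp_bip_into_eqI = biproduct_into_eqI[OF is_biproduct_susp_bip, unfolded susp_bip_def, simplified]

lemma candidate_iff:
  "candidate_triangle T (u, v, w) \<longleftrightarrow> u \<in> Arr T \<and> v \<in> Arr T \<and> w \<in> Arr T \<and>
     Dom T v = Cod T u \<and> Dom T w = Cod T v \<and> Cod T w = \<Sigma>o (Dom T u) \<and>
     v \<cdot> u = Zero T (Dom T u) (Cod T v) \<and> w \<cdot> v = Zero T (Cod T u) (\<Sigma>o (Dom T u)) \<and>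
     \<Sigma>a u \<cdot> w = Zero T (Cod T v) (\<Sigma>o (Cod T u))"
  by auto

end

section \<open>Distinguished triangles: exactness, comparison, retracts\<close>

locale pretriangulated = suspended T for T :: "('o, 'm) suspended_cat" (structure) +
  fixes \<Delta> :: "'m triangle set"
  assumes pretriangulated: "pre_triangulated T \<Delta>"
begin

lemma candidate: "t \<in> \<Delta> \<Longrightarrow> candidate_triangle T t"
  using pretriangulated by (simp add: pre_triangulated_def)

lemma distD:
  assumes "(u, v, w) \<in> \<Delta>"
  shows "u \<in> Arr T" "v \<in> Arr T" "w \<in> Arr T"
    "Dom T v = Cod T u" "Dom T w = Cod T v" "Cod T w = \<Sigma>o (Dom T u)"
    "v \<cdot> u = Zero T (Dom T u) (Cod T v)" "w \<cdot> v = Zero T (Cod T u) (\<Sigma>o (Dom T u))"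
    "\<Sigma>a u \<cdot> w = Zero T (Cod T v) (\<Sigma>o (Cod T u))"
    "\<And>x. x \<in> Arr T \<Longrightarrow> Cod T x = Dom T u \<Longrightarrow> v \<cdot> (u \<cdot> x) = Zero T (Dom T x) (Cod T v)"
    "\<And>x. x \<in> Arr T \<Longrightarrow> Cod T x = Cod T u \<Longrightarrow> w \<cdot> (v \<cdot> x) = Zero T (Dom T x) (\<Sigma>o (Dom T u))"
    "\<And>x. x \<in> Arr T \<Longrightarrow> Cod T x = Cod T v \<Longrightarrow> \<Sigma>a u \<cdot> (w \<cdot> x) = Zero T (Dom T x) (\<Sigma>o (Cod T u))"
proof -
  note D = candidate[OF assms, unfolded candidate_iff]
  show "u \<in> Arr T" "v \<in> Arr T" "w \<in> Arr T"
    "Dom T v = Cod T u" "Dom T w = Cod T v" "Cod T w = \<Sigma>o (Dom T u)"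
    "v \<cdot> u = Zero T (Dom T u) (Cod T v)" "w \<cdot> v = Zero T (Cod T u) (\<Sigma>o (Dom T u))"
    "\<Sigma>a u \<cdot> w = Zero T (Cod T v) (\<Sigma>o (Cod T u))"
    using D by auto
  show "v \<cdot> (u \<cdot> x) = Zero T (Dom T x) (Cod T v)" if "x \<in> Arr T" "Cod T x = Dom T u" for x
    by (subst comp_reassoc) (use that D in auto)
  show "w \<cdot> (v \<cdot> x) = Zero T (Dom T x) (\<Sigma>o (Dom T u))" if "x \<in> Arr T" "Cod T x = Cod T u" for x
    by (subst comp_reassoc) (use that D in auto)
  show "\<Sigma>a u \<cdot> (w \<cdot> x) = Zero T (Dom T x) (\<Sigma>o (Cod T u))" if "x \<in> Arr T" "Cod T x = Cod T v" for x
    by (subst comp_reassoc) (use that D in auto)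
qed

lemma susp_distD:
  assumes "(u, v, w) \<in> \<Delta>"
  shows "\<Sigma>a v \<cdot> \<Sigma>a u = Zero T (\<Sigma>o (Dom T u)) (\<Sigma>o (Cod T v))"
    "\<And>x. x \<in> Arr T \<Longrightarrow> Cod T x = \<Sigma>o (Dom T u) \<Longrightarrow>
      \<Sigma>a v \<cdot> (\<Sigma>a u \<cdot> x) = Zero T (Dom T x) (\<Sigma>o (Cod T v))"
proof -
  note [simp] = distD[OF assms]
  show *: "\<Sigma>a v \<cdot> \<Sigma>a u = Zero T (\<Sigma>o (Dom T u)) (\<Sigma>o (Cod T v))"
    using susp_comp[of u v] by simp
  show "\<Sigma>a v \<cdot> (\<Sigma>a u \<cdot> x) = Zero T (Dom T x) (\<Sigma>o (Cod T v))"
    if "x \<in> Arr T" "Cod T x = \<Sigma>o (Dom T u)" for x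
    using that by (simp add: comp_reassoc[OF *])
qed

lemma rotate: "(u, v, w) \<in> \<Delta> \<Longrightarrow> (v, w, \<ominus> (\<Sigma>a u)) \<in> \<Delta>"
  using pretriangulated candidate[of "(u, v, w)"] unfolding pre_triangulated_def TR2_def
  by (metis candidate_triangle.simps)

lemma extend_arrow:
  assumes "u \<in> Arr T" obtains v w where "(u, v, w) \<in> \<Delta>"
  using pretriangulated assms unfolding pre_triangulated_def TR1_def by blast

lemma iso_closed:
  assumes "t \<in> \<Delta>" "candidate_triangle T t'" "triangle_iso T t t'"
  shows "t' \<in> \<Delta>"
proof -
  have "TR1 T \<Delta>" using pretriangulated by (simp add: pre_triangulated_def)
  then show ?thesis using assms by (metis TR1_def)
qed

lemma triangle_map:
  assumes "(u, v, w) \<in> \<Delta>" "(u', v', w') \<in> \<Delta>" "f \<in> Arr T" "g \<in> Arr T"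
    "Dom T f = Dom T u" "Cod T f = Dom T u'" "Dom T g = Cod T u" "Cod T g = Cod T u'"
    "g \<cdot> u = u' \<cdot> f"
  obtains h where "h \<in> Arr T" "Dom T h = Cod T v" "Cod T h = Cod T v'"
    "h \<cdot> v = v' \<cdot> g" "w' \<cdot> h = \<Sigma>a f \<cdot> w"
proof -
  have "TR3 T \<Delta>" using pretriangulated by (simp add: pre_triangulated_def)
  then have "\<exists>h. triangle_morphism T (u, v, w) (u', v', w') f g h"
    unfolding TR3_def using assms by (auto simp: mor_def simp del: triangle_morphism.simps)
  then show ?thesis
    using that distD[OF assms(1)] distD[OF assms(2)] by (auto simp: mor_def)
qed

text \<open>A map \<open>y\<close> from W with \<open>v \<cdot> y\<close> zero is a square from the
  rotated trivial triangle W -> 0 -> \<Sigma>W to the rotation of \<open>(u, v, w)\<close>. The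
  third map given by TR3 goes from \<Sigma>W to \<Sigma>X; it is a suspension by fullness, and
  faithfulness removes \<Sigma> from the resulting equation.\<close>

lemma hom_exact_dist:
  assumes D: "(u, v, w) \<in> \<Delta>"
  shows "hom_exact u v"
proof (rule hom_exactI)
  fix y assume y: "y \<in> Arr T" "Cod T y = Cod T u" and vy: "v \<cdot> y = Zero T (Dom T y) (Cod T v)"
  let ?W = "Dom T y"
  note [simp] = distD[OF D] y
  obtain N where N: "zero_object T N"
    using additive by (auto simp: additive_category_def)
  have [simp]: "N \<in> Obj T" using N by (simp add: zero_object_def)
  have "(Idt T ?W, Zero T ?W N, Zero T N (\<Sigma>o ?W)) \<in> \<Delta>"
    using pretriangulated N unfolding pre_triangulated_def TR1_def by (simp add: y)
  from rotate[OF this] have E: "(Zero T ?W N, Zero T N (\<Sigma>o ?W), \<ominus> (Idt T (\<Sigma>o ?W))) \<in> \<Delta>"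
    by simp
  obtain h where h: "h \<in> Arr T" "Dom T h = \<Sigma>o ?W" "Cod T h = Cod T w"
    "\<ominus> (\<Sigma>a u) \<cdot> h = \<Sigma>a y \<cdot> \<ominus> (Idt T (\<Sigma>o ?W))"
    using triangle_map[OF E rotate[OF D], of y "Zero T N (Cod T v)"] vy by auto
  obtain x where x: "x \<in> mor T ?W (Dom T u)" "\<Sigma>a x = h"
    using susp_full[of ?W "Dom T u" h] h by (auto simp: mor_def)
  have "\<Sigma>a (u \<cdot> x) = \<Sigma>a y"
    using h x by (simp add: mor_def neg_inject)
  then have "u \<cdot> x = y"
    using x by (intro susp_faithful[of "u \<cdot> x" ?W "Cod T u" y]) (simp_all add: mor_def)
  then show "\<exists>x\<in>Arr T. Dom T x = Dom T y \<and> Cod T x = Dom T u \<and> u \<cdot> x = y"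
    using x by (auto simp: mor_def)
qed

lemma hom_exact_dist':
  assumes D: "(u, v, w) \<in> \<Delta>"
  shows "hom_exact v w" "hom_exact w (\<Sigma>a u)"
proof -
  show "hom_exact v w" using hom_exact_dist[OF rotate[OF D]] .
  \<comment> \<open>The sign introduced by rotation changes no kernel.\<close>
  have "hom_exact w (\<ominus> (\<Sigma>a u))" using hom_exact_dist[OF rotate[OF rotate[OF D]]] .
  then show "hom_exact w (\<Sigma>a u)"
    using distD[OF D] by (auto simp: hom_exact_def)
qed

text \<open>This is the five lemma by an element chase. Arrows into the objects play the role of
  elements, and exactness of the candidate at its two middle terms suffices, since the other
  triangle is exact everywhere.\<close>

lemma comparison_iso:
  assumes C: "candidate_triangle T (u, v, w)" and ex: "hom_exact u v" "hom_exact v w"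
    and D: "(u, s, t) \<in> \<Delta>"
    and \<chi>: "\<chi> \<in> Arr T" "Dom T \<chi> = Cod T s" "Cod T \<chi> = Cod T v" "\<chi> \<cdot> s = v" "w \<cdot> \<chi> = t"
  obtains \<rho> where "\<rho> \<in> Arr T" "Dom T \<rho> = Cod T v" "Cod T \<rho> = Cod T s"
    "\<chi> \<cdot> \<rho> = Idt T (Cod T v)" "\<rho> \<cdot> \<chi> = Idt T (Cod T s)"
proof -
  note C' = C[unfolded candidate_iff]
  have [simp]: "w \<in> Arr T" "v \<in> Arr T" "Dom T v = Cod T u" "Dom T w = Cod T v" "Cod T w = \<Sigma>o (Dom T u)"
    "\<Sigma>a u \<cdot> w = Zero T (Cod T v) (\<Sigma>o (Cod T u))" "v \<cdot> u = Zero T (Dom T u) (Cod T v)"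
    using C' by blast+
  note [simp] = distD[OF D] \<chi>
  \<comment> \<open>Injectivity: \<open>x\<close> dies under \<open>t\<close>, so it is
    \<open>s \<cdot> y\<close>; then \<open>y\<close> dies under \<open>v\<close>, so it comes from
    \<open>u\<close>, and \<open>s \<cdot> u\<close> is zero.\<close>
  have inj: "x = Zero T (Dom T x) (Cod T s)"
    if x [simp]: "x \<in> Arr T" "Cod T x = Cod T s" and 0: "\<chi> \<cdot> x = Zero T (Dom T x) (Cod T v)" for x
  proof -
    have "t \<cdot> x = Zero T (Dom T x) (Cod T t)" using comp_reassoc[OF \<chi>(5), of x] 0 by simp
    then obtain y where y: "y \<in> Arr T" "Dom T y = Dom T x" "Cod T y = Dom T s" "s \<cdot> y = x"
      using hom_exactE[OF hom_exact_dist'(1)[OF D], of x] by auto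
    have "v \<cdot> y = Zero T (Dom T y) (Cod T v)" using comp_reassoc[OF \<chi>(4), of y] 0 y by simp
    then obtain z where z: "z \<in> Arr T" "Dom T z = Dom T y" "Cod T z = Dom T u" "u \<cdot> z = y"
      using hom_exactE[OF ex(1), of y] y by auto
    have "s \<cdot> (u \<cdot> z) = Zero T (Dom T x) (Cod T s)" using y(2) z(1-3) by simp
    then show ?thesis by (simp only: y(4) z(4))
  qed
  \<comment> \<open>Surjectivity, tested on the identity: first lift \<open>w\<close> along
    \<open>t\<close>. The resulting error \<open>1 - \<chi> x\<close> is killed by \<open>w\<close>,
    hence factors as \<open>v \<cdot> y = \<chi> s y\<close>, and adding \<open>s \<cdot> y\<close>
    repairs the lift.\<close>
  obtain x where x: "x \<in> Arr T" "Dom T x = Cod T v" "Cod T x = Dom T t" "t \<cdot> x = w"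
    by (rule hom_exactE[OF hom_exact_dist'(2)[OF D], of w]) simp_all
  have "w \<cdot> (Idt T (Cod T v) \<boxplus> \<ominus> (\<chi> \<cdot> x)) = Zero T (Cod T v) (Cod T w)"
    using x comp_reassoc[OF \<chi>(5), of x] by simp
  then obtain y where y: "y \<in> Arr T" "Dom T y = Cod T v" "Cod T y = Cod T u"
      "v \<cdot> y = Idt T (Cod T v) \<boxplus> \<ominus> (\<chi> \<cdot> x)"
    using hom_exactE[OF ex(2), of "Idt T (Cod T v) \<boxplus> \<ominus> (\<chi> \<cdot> x)"] x by auto
  define \<rho> where "\<rho> = x \<boxplus> (s \<cdot> y)"
  have \<rho>: "\<rho> \<in> Arr T" "Dom T \<rho> = Cod T v" "Cod T \<rho> = Cod T s"
    using x y by (simp_all add: \<rho>_def)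
  have r: "\<chi> \<cdot> \<rho> = Idt T (Cod T v)"
    using x y comp_reassoc[OF \<chi>(4), of y] by (simp add: \<rho>_def add_ac)
  \<comment> \<open>A right inverse of an arrow that kills nothing is two-sided:
    \<open>\<chi>\<close> annihilates \<open>\<rho> \<chi> - 1\<close>.\<close>
  have "(\<rho> \<cdot> \<chi>) \<boxplus> \<ominus> (Idt T (Cod T s)) = Zero T (Cod T s) (Cod T s)"
    using inj[of "(\<rho> \<cdot> \<chi>) \<boxplus> \<ominus> (Idt T (Cod T s))"] \<rho> by (simp add: comp_reassoc[OF r])
  then have l: "\<rho> \<cdot> \<chi> = Idt T (Cod T s)"
    using \<rho> by (simp add: add_eq_zero_iff neg_inject)
  show thesis using that[OF \<rho> r l] .
qed

text \<open>Together with two identities, \<open>\<chi>\<close> is an isomorphism of triangles, so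
  closure under isomorphism applies. This is the criterion behind every later proof that a triangle
  is distinguished: retracts, mapping cones and the two factors of \<alpha>.\<close>

lemma distinguishedI:
  assumes C: "candidate_triangle T (u, v, w)" and ex: "hom_exact u v" "hom_exact v w"
    and D: "(u, s, t) \<in> \<Delta>"
    and \<chi>: "\<chi> \<in> Arr T" "Dom T \<chi> = Cod T s" "Cod T \<chi> = Cod T v" "\<chi> \<cdot> s = v" "w \<cdot> \<chi> = t"
  shows "(u, v, w) \<in> \<Delta>"
proof -
  obtain \<rho> where \<rho>: "\<rho> \<in> Arr T" "Dom T \<rho> = Cod T v" "Cod T \<rho> = Cod T s"
    and r: "\<chi> \<cdot> \<rho> = Idt T (Cod T v)" and l: "\<rho> \<cdot> \<chi> = Idt T (Cod T s)"
    by (rule comparison_iso[OF C ex D \<chi>])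
  have [simp]: "w \<in> Arr T" "v \<in> Arr T" "Dom T v = Cod T u" "Dom T w = Cod T v" "Cod T w = \<Sigma>o (Dom T u)"
    using C[unfolded candidate_iff] by blast+
  note [simp] = distD[OF D] \<chi>
  have "triangle_iso T (u, s, t) (u, v, w)"
    unfolding triangle_iso_def
  proof (intro exI conjI)
    show "triangle_morphism T (u, s, t) (u, v, w) (Idt T (Dom T u)) (Idt T (Cod T u)) \<chi>"
      by (auto simp: mor_def)
    show "iso_arrow T (Idt T (Dom T u))" "iso_arrow T (Idt T (Cod T u))"
      by (auto simp: iso_arrow_def mor_def intro!: bexI[of _ "Idt T _"])
    show "iso_arrow T \<chi>"
      using \<rho> l r by (auto simp: iso_arrow_def mor_def intro!: bexI[of _ \<rho>])
  qed
  then show ?thesis by (rule iso_closed[OF D C])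
qed

text \<open>A retract of an exact sequence is exact. The comparison map required by
  \<open>distinguishedI\<close> runs from a distinguished triangle on \<open>u'\<close> into the big
  triangle by TR3 and back along \<open>p3\<close>.\<close>

lemma retract_distinguished:
  assumes C: "candidate_triangle T (u', v', w')" and D: "(u, v, w) \<in> \<Delta>"
    and i: "triangle_morphism T (u', v', w') (u, v, w) i1 i2 i3"
    and p: "triangle_morphism T (u, v, w) (u', v', w') p1 p2 p3"
    and pi: "p1 \<cdot> i1 = Idt T (Dom T u')" "p2 \<cdot> i2 = Idt T (Cod T u')" "p3 \<cdot> i3 = Idt T (Cod T v')"
  shows "(u', v', w') \<in> \<Delta>"
proof -
  note [simp] = distD[OF D]
  have [simp]: "u' \<in> Arr T" "v' \<in> Arr T" "w' \<in> Arr T"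
    "Dom T v' = Cod T u'" "Dom T w' = Cod T v'" "Cod T w' = \<Sigma>o (Dom T u')"
    using C by (auto simp del: candidate_triangle.simps simp: candidate_iff)
  have [simp]: "i1 \<in> Arr T" "i2 \<in> Arr T" "i3 \<in> Arr T"
    "Dom T i1 = Dom T u'" "Dom T i2 = Cod T u'" "Dom T i3 = Cod T v'"
    "Cod T i1 = Dom T u" "Cod T i2 = Cod T u" "Cod T i3 = Cod T v"
    "p1 \<in> Arr T" "p2 \<in> Arr T" "p3 \<in> Arr T"
    "Cod T p1 = Dom T u'" "Cod T p2 = Cod T u'" "Cod T p3 = Cod T v'"
    "Dom T p1 = Dom T u" "Dom T p2 = Cod T u" "Dom T p3 = Cod T v"
    using i p by (auto simp: mor_def)
  have ie: "i2 \<cdot> u' = u \<cdot> i1" "i3 \<cdot> v' = v \<cdot> i2" "w \<cdot> i3 = \<Sigma>a i1 \<cdot> w'"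
    and pe: "p2 \<cdot> u = u' \<cdot> p1" "p3 \<cdot> v = v' \<cdot> p2" "w' \<cdot> p3 = \<Sigma>a p1 \<cdot> w"
    using i p by auto
  note re = ie[THEN comp_reassoc] pe[THEN comp_reassoc] pi[THEN comp_reassoc]
  have ex1: "hom_exact u' v'"
  proof (rule hom_exactI)
    fix y assume y: "y \<in> Arr T" "Cod T y = Cod T u'" and 0: "v' \<cdot> y = Zero T (Dom T y) (Cod T v')"
    have "v \<cdot> (i2 \<cdot> y) = i3 \<cdot> (v' \<cdot> y)" using y by (simp add: re)
    then have "v \<cdot> (i2 \<cdot> y) = Zero T (Dom T y) (Cod T v)" using 0 y by simp
    then obtain x where x: "x \<in> Arr T" "Dom T x = Dom T y" "Cod T x = Dom T u" "u \<cdot> x = i2 \<cdot> y"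
      using hom_exactE[OF hom_exact_dist[OF D], of "i2 \<cdot> y"] y by auto
    have "u' \<cdot> (p1 \<cdot> x) = p2 \<cdot> (u \<cdot> x)" using x(1-3) by (simp add: re)
    also have "\<dots> = y" using x y by (simp add: re)
    finally show "\<exists>x\<in>Arr T. Dom T x = Dom T y \<and> Cod T x = Dom T u' \<and> u' \<cdot> x = y"
      using x by (intro bexI[of _ "p1 \<cdot> x"]) auto
  qed
  have ex2: "hom_exact v' w'"
  proof (rule hom_exactI)
    fix y assume y: "y \<in> Arr T" "Cod T y = Cod T v'" and 0: "w' \<cdot> y = Zero T (Dom T y) (Cod T w')"
    have "w \<cdot> (i3 \<cdot> y) = \<Sigma>a i1 \<cdot> (w' \<cdot> y)" using y by (simp add: re)
    then have "w \<cdot> (i3 \<cdot> y) = Zero T (Dom T y) (Cod T w)" using 0 y by simp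
    then obtain x where x: "x \<in> Arr T" "Dom T x = Dom T y" "Cod T x = Dom T v" "v \<cdot> x = i3 \<cdot> y"
      using hom_exactE[OF hom_exact_dist'(1)[OF D], of "i3 \<cdot> y"] y by auto
    have "v' \<cdot> (p2 \<cdot> x) = p3 \<cdot> (v \<cdot> x)" using x(1-3) by (simp add: re)
    also have "\<dots> = y" using x y by (simp add: re)
    finally show "\<exists>x\<in>Arr T. Dom T x = Dom T y \<and> Cod T x = Dom T v' \<and> v' \<cdot> x = y"
      using x by (intro bexI[of _ "p2 \<cdot> x"]) auto
  qed
  obtain s t where E: "(u', s, t) \<in> \<Delta>" using extend_arrow[of u'] by auto
  note [simp] = distD[OF E]
  \<comment> \<open>TR3 is used over \<open>i1\<close> and \<open>i2\<close> only; its third map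
    need not be compatible with \<open>i3\<close>.\<close>
  obtain h where h: "h \<in> Arr T" "Dom T h = Cod T s" "Cod T h = Cod T v"
    "h \<cdot> s = v \<cdot> i2" "w \<cdot> h = \<Sigma>a i1 \<cdot> t"
    using triangle_map[OF E D, of i1 i2] ie by auto
  have "\<Sigma>a p1 \<cdot> \<Sigma>a i1 = Idt T (\<Sigma>o (Dom T u'))"
    using arg_cong[OF pi(1), of "\<Sigma>a"] by simp
  note re' = this[THEN comp_reassoc]
  show ?thesis
  proof (rule distinguishedI[OF C ex1 ex2 E])
    show "p3 \<cdot> h \<in> Arr T" "Dom T (p3 \<cdot> h) = Cod T s" "Cod T (p3 \<cdot> h) = Cod T v'"
      using h by auto
    show "(p3 \<cdot> h) \<cdot> s = v'" using h by (simp add: re pi)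
    show "w' \<cdot> (p3 \<cdot> h) = t" using h by (simp add: re re')
  qed
qed

text \<open>This permits passing from one chosen triangle on an arrow to an arbitrary one, as is
  needed when a good completion is known only for one square per composable pair.\<close>

lemma distinguished_unique:
  assumes D: "(u, v, w) \<in> \<Delta>" "(u, v', w') \<in> \<Delta>"
  obtains \<phi> \<psi> where "\<phi> \<in> mor T (Cod T v) (Cod T v')" "\<psi> \<in> mor T (Cod T v') (Cod T v)"
    "\<phi> \<cdot> \<psi> = Idt T (Cod T v')" "\<psi> \<cdot> \<phi> = Idt T (Cod T v)"
    "\<phi> \<cdot> v = v'" "w' \<cdot> \<phi> = w" "\<psi> \<cdot> v' = v" "w \<cdot> \<psi> = w'"
proof -
  note [simp] = distD[OF D(1)] distD[OF D(2)]
  obtain \<phi> where \<phi>: "\<phi> \<in> Arr T" "Dom T \<phi> = Cod T v" "Cod T \<phi> = Cod T v'" "\<phi> \<cdot> v = v'" "w' \<cdot> \<phi> = w"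
    by (rule triangle_map[OF D, of "Idt T (Dom T u)" "Idt T (Cod T u)"]) simp_all
  obtain \<psi> where \<psi>: "\<psi> \<in> Arr T" "Dom T \<psi> = Cod T v'" "Cod T \<psi> = Cod T v"
    "\<phi> \<cdot> \<psi> = Idt T (Cod T v')" "\<psi> \<cdot> \<phi> = Idt T (Cod T v)"
    by (rule comparison_iso[OF candidate[OF D(2)] hom_exact_dist[OF D(2)] hom_exact_dist'(1)[OF D(2)] D(1) \<phi>])
  have "\<psi> \<cdot> (\<phi> \<cdot> v) = v" "(w' \<cdot> \<phi>) \<cdot> \<psi> = w'"
    using \<phi>(1-3) \<psi>(1-3) by (simp_all add: \<psi>(4) comp_reassoc[OF \<psi>(5)])
  then have "\<psi> \<cdot> v' = v" "w \<cdot> \<psi> = w'" by (simp_all only: \<phi>(4,5))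
  then show thesis
    using \<phi> \<psi> by (intro that[of \<phi> \<psi>]) (simp_all add: mor_def)
qed

end

section \<open>Block matrices between biproducts\<close>

context additive
begin

lemma block_arr [simp]:
  assumes "a \<in> Arr T" "b \<in> Arr T" "c \<in> Arr T" "d \<in> Arr T"
    "Dom T a = X" "Dom T c = X" "Dom T b = Y" "Dom T d = Y"
    "Cod T a = V" "Cod T b = V" "Cod T c = W" "Cod T d = W"
  shows "block T (Bip T X Y) (Bip T V W) a b c d \<in> Arr T"
    "Dom T (block T (Bip T X Y) (Bip T V W) a b c d) = apex (Bip T X Y)"
    "Cod T (block T (Bip T X Y) (Bip T V W) a b c d) = apex (Bip T V W)"
  using assms by (auto simp: block_def)

lemma prj_block [simp]:
  assumes "a \<in> Arr T" "b \<in> Arr T" "c \<in> Arr T" "d \<in> Arr T"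
    "Dom T a = X" "Dom T c = X" "Dom T b = Y" "Dom T d = Y"
    "Cod T a = V" "Cod T b = V" "Cod T c = W" "Cod T d = W"
  shows "prj1 (Bip T V W) \<cdot> block T (Bip T X Y) (Bip T V W) a b c d =
      (a \<cdot> prj1 (Bip T X Y)) \<boxplus> (b \<cdot> prj2 (Bip T X Y))"
    "prj2 (Bip T V W) \<cdot> block T (Bip T X Y) (Bip T V W) a b c d =
      (c \<cdot> prj1 (Bip T X Y)) \<boxplus> (d \<cdot> prj2 (Bip T X Y))"
  using assms by (auto simp: block_def)

lemma prj_block_comp [simp]:
  assumes "a \<in> Arr T" "b \<in> Arr T" "c \<in> Arr T" "d \<in> Arr T"
    "Dom T a = X" "Dom T c = X" "Dom T b = Y" "Dom T d = Y"
    "Cod T a = V" "Cod T b = V" "Cod T c = W" "Cod T d = W"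
    "x \<in> Arr T" "Cod T x = apex (Bip T X Y)"
  shows "prj1 (Bip T V W) \<cdot> (block T (Bip T X Y) (Bip T V W) a b c d \<cdot> x) =
      (a \<cdot> (prj1 (Bip T X Y) \<cdot> x)) \<boxplus> (b \<cdot> (prj2 (Bip T X Y) \<cdot> x))"
    "prj2 (Bip T V W) \<cdot> (block T (Bip T X Y) (Bip T V W) a b c d \<cdot> x) =
      (c \<cdot> (prj1 (Bip T X Y) \<cdot> x)) \<boxplus> (d \<cdot> (prj2 (Bip T X Y) \<cdot> x))"
  using assms by (auto simp: comp_reassoc[OF prj_block(1)] comp_reassoc[OF prj_block(2)])

lemma block_inject:
  assumes "a \<in> Arr T" "b \<in> Arr T" "c \<in> Arr T" "d \<in> Arr T"
    "Dom T a = X" "Dom T c = X" "Dom T b = Y" "Dom T d = Y"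
    "Cod T a = V" "Cod T b = V" "Cod T c = W" "Cod T d = W"
  shows "prj1 (Bip T V W) \<cdot> (block T (Bip T X Y) (Bip T V W) a b c d \<cdot> inj1 (Bip T X Y)) = a"
    "prj1 (Bip T V W) \<cdot> (block T (Bip T X Y) (Bip T V W) a b c d \<cdot> inj2 (Bip T X Y)) = b"
    "prj2 (Bip T V W) \<cdot> (block T (Bip T X Y) (Bip T V W) a b c d \<cdot> inj1 (Bip T X Y)) = c"
    "prj2 (Bip T V W) \<cdot> (block T (Bip T X Y) (Bip T V W) a b c d \<cdot> inj2 (Bip T X Y)) = d"
  using assms by auto

lemma block_add:
  assumes "a \<in> Arr T" "b \<in> Arr T" "c \<in> Arr T" "d \<in> Arr T"
    "a' \<in> Arr T" "b' \<in> Arr T" "c' \<in> Arr T" "d' \<in> Arr T"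
    "Dom T a = X" "Dom T c = X" "Dom T b = Y" "Dom T d = Y"
    "Cod T a = V" "Cod T b = V" "Cod T c = W" "Cod T d = W"
    "Dom T a' = X" "Dom T c' = X" "Dom T b' = Y" "Dom T d' = Y"
    "Cod T a' = V" "Cod T b' = V" "Cod T c' = W" "Cod T d' = W"
  shows "block T (Bip T X Y) (Bip T V W) a b c d \<boxplus> block T (Bip T X Y) (Bip T V W) a' b' c' d' =
    block T (Bip T X Y) (Bip T V W) (a \<boxplus> a') (b \<boxplus> b') (c \<boxplus> c') (d \<boxplus> d')"
proof -
  have o: "X \<in> Obj T" "Y \<in> Obj T" "V \<in> Obj T" "W \<in> Obj T" using assms by auto
  show ?thesis
    by (rule bip_into_eqI[of V W]) (use o assms in \<open>simp_all add: add_ac\<close>)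
qed

lemma block_neg:
  assumes "a \<in> Arr T" "b \<in> Arr T" "c \<in> Arr T" "d \<in> Arr T"
    "Dom T a = X" "Dom T c = X" "Dom T b = Y" "Dom T d = Y"
    "Cod T a = V" "Cod T b = V" "Cod T c = W" "Cod T d = W"
  shows "\<ominus> (block T (Bip T X Y) (Bip T V W) a b c d) =
    block T (Bip T X Y) (Bip T V W) (\<ominus> a) (\<ominus> b) (\<ominus> c) (\<ominus> d)"
proof -
  have o: "X \<in> Obj T" "Y \<in> Obj T" "V \<in> Obj T" "W \<in> Obj T" using assms by auto
  show ?thesis
    by (rule bip_into_eqI[of V W]) (use o assms in simp_all)
qed

lemma block_eq_iff:
  assumes "a \<in> Arr T" "b \<in> Arr T" "c \<in> Arr T" "d \<in> Arr T"
    "Dom T a = X" "Dom T c = X" "Dom T b = Y" "Dom T d = Y"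
    "Cod T a = V" "Cod T b = V" "Cod T c = W" "Cod T d = W"
    "m \<in> Arr T" "Dom T m = apex (Bip T X Y)" "Cod T m = apex (Bip T V W)"
  shows "m = block T (Bip T X Y) (Bip T V W) a b c d \<longleftrightarrow>
    prj1 (Bip T V W) \<cdot> (m \<cdot> inj1 (Bip T X Y)) = a \<and> prj1 (Bip T V W) \<cdot> (m \<cdot> inj2 (Bip T X Y)) = b \<and>
    prj2 (Bip T V W) \<cdot> (m \<cdot> inj1 (Bip T X Y)) = c \<and> prj2 (Bip T V W) \<cdot> (m \<cdot> inj2 (Bip T X Y)) = d"
    (is "?l = ?r")
proof
  have o: "X \<in> Obj T" "Y \<in> Obj T" "V \<in> Obj T" "W \<in> Obj T" using assms by auto
  show ?r if ?l
    unfolding that using block_inject[OF assms(1-12)] by blast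
  assume r: ?r
  have eq: "prj1 (Bip T V W) \<cdot> m = (a \<cdot> prj1 (Bip T X Y)) \<boxplus> (b \<cdot> prj2 (Bip T X Y))"
    "prj2 (Bip T V W) \<cdot> m = (c \<cdot> prj1 (Bip T X Y)) \<boxplus> (d \<cdot> prj2 (Bip T X Y))"
    by (rule bip_from_eqI[of X Y]; use o r assms in simp)+
  show ?l
    by (rule bip_into_eqI[OF o(3,4)]) (use assms o eq in simp_all)
qed

end

context suspended
begin

text \<open>Matrices into a suspended direct sum need rules of their own, because the projections
  there are the suspended ones.\<close>

lemma susp_block_arr [simp]:
  assumes "a \<in> Arr T" "b \<in> Arr T" "c \<in> Arr T" "d \<in> Arr T" "V \<in> Obj T" "W \<in> Obj T"
    "Dom T a = X" "Dom T c = X" "Dom T b = Y" "Dom T d = Y"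
    "Cod T a = \<Sigma>o V" "Cod T b = \<Sigma>o V" "Cod T c = \<Sigma>o W" "Cod T d = \<Sigma>o W"
  shows "block T (Bip T X Y) (susp_bip T (Bip T V W)) a b c d \<in> Arr T"
    "Dom T (block T (Bip T X Y) (susp_bip T (Bip T V W)) a b c d) = apex (Bip T X Y)"
    "Cod T (block T (Bip T X Y) (susp_bip T (Bip T V W)) a b c d) = \<Sigma>o (apex (Bip T V W))"
  using assms by (auto simp: block_def susp_bip_def)

lemma susp_prj_block [simp]:
  assumes "a \<in> Arr T" "b \<in> Arr T" "c \<in> Arr T" "d \<in> Arr T" "V \<in> Obj T" "W \<in> Obj T"
    "Dom T a = X" "Dom T c = X" "Dom T b = Y" "Dom T d = Y"
    "Cod T a = \<Sigma>o V" "Cod T b = \<Sigma>o V" "Cod T c = \<Sigma>o W" "Cod T d = \<Sigma>o W"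
  shows "\<Sigma>a (prj1 (Bip T V W)) \<cdot> block T (Bip T X Y) (susp_bip T (Bip T V W)) a b c d =
      (a \<cdot> prj1 (Bip T X Y)) \<boxplus> (b \<cdot> prj2 (Bip T X Y))"
    "\<Sigma>a (prj2 (Bip T V W)) \<cdot> block T (Bip T X Y) (susp_bip T (Bip T V W)) a b c d =
      (c \<cdot> prj1 (Bip T X Y)) \<boxplus> (d \<cdot> prj2 (Bip T X Y))"
  using assms by (auto simp: block_def susp_bip_def)

lemma susp_prj_block_comp [simp]:
  assumes "a \<in> Arr T" "b \<in> Arr T" "c \<in> Arr T" "d \<in> Arr T" "V \<in> Obj T" "W \<in> Obj T"
    "Dom T a = X" "Dom T c = X" "Dom T b = Y" "Dom T d = Y"
    "Cod T a = \<Sigma>o V" "Cod T b = \<Sigma>o V" "Cod T c = \<Sigma>o W" "Cod T d = \<Sigma>o W"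
    "x \<in> Arr T" "Cod T x = apex (Bip T X Y)"
  shows "\<Sigma>a (prj1 (Bip T V W)) \<cdot> (block T (Bip T X Y) (susp_bip T (Bip T V W)) a b c d \<cdot> x) =
      (a \<cdot> (prj1 (Bip T X Y) \<cdot> x)) \<boxplus> (b \<cdot> (prj2 (Bip T X Y) \<cdot> x))"
    "\<Sigma>a (prj2 (Bip T V W)) \<cdot> (block T (Bip T X Y) (susp_bip T (Bip T V W)) a b c d \<cdot> x) =
      (c \<cdot> (prj1 (Bip T X Y) \<cdot> x)) \<boxplus> (d \<cdot> (prj2 (Bip T X Y) \<cdot> x))"
  using assms by (auto simp: comp_reassoc[OF susp_prj_block(1)] comp_reassoc[OF susp_prj_block(2)])

end

section \<open>Initial squares and the obstruction\<close>

locale square = pretriangulated T \<Delta> for T :: "('o, 'm) suspended_cat" (structure) and \<Delta> +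
  fixes u v w u' v' w' f g
  assumes initial: "initial_square T \<Delta> ((u, v, w), (u', v', w'), f, g)"
begin

abbreviation "A \<equiv> Bip T (Cod T u) (Dom T u')"
abbreviation "B \<equiv> Bip T (Cod T v) (Cod T u')"
abbreviation "C \<equiv> Bip T (\<Sigma>o (Dom T u)) (Cod T v')"
text \<open>On an explicit square \<open>cone_alpha\<close>, \<open>cone_beta\<close> and
  \<open>cone_gamma\<close> unfold to these matrices, so the block rules apply to them
  directly.\<close>

abbreviation "\<alpha> \<equiv> block T A B (\<ominus> v) (Zero T (Dom T u') (Cod T v)) g u'"
abbreviation "\<beta> h \<equiv> block T B C (\<ominus> w) (Zero T (Cod T u') (\<Sigma>o (Dom T u))) h v'"
abbreviation "\<gamma> \<equiv> block T C (susp_bip T A) (\<ominus> (\<Sigma>a u)) (Zero T (Cod T v') (\<Sigma>o (Cod T u))) (\<Sigma>a f) w'"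
abbreviation "q \<equiv> ((u, v, w), (u', v', w'), f, g)"

lemma D1: "(u, v, w) \<in> \<Delta>" and D2: "(u', v', w') \<in> \<Delta>" and fg: "g \<cdot> u = u' \<cdot> f"
  using initial by auto

lemmas [simp] = distD[OF D1] distD[OF D2] susp_distD[OF D1] susp_distD[OF D2]

lemma verticals [simp]:
  "f \<in> Arr T" "Dom T f = Dom T u" "Cod T f = Dom T u'"
  "g \<in> Arr T" "Dom T g = Cod T u" "Cod T g = Cod T u'"
  using initial by (auto simp: mor_def)

lemma susp_square: "\<Sigma>a g \<cdot> \<Sigma>a u = \<Sigma>a u' \<cdot> \<Sigma>a f"
  using arg_cong[OF fg, of "\<Sigma>a"] by simp

lemma completion_iff:
  "completion T q h \<longleftrightarrow> h \<in> Arr T \<and> Dom T h = Cod T v \<and> Cod T h = Cod T v' \<and>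
     h \<cdot> v = v' \<cdot> g \<and> w' \<cdot> h = \<Sigma>a f \<cdot> w"
  using fg by (auto simp: mor_def)

lemma alpha_arr [simp]: "\<alpha> \<in> Arr T" "Dom T \<alpha> = apex A" "Cod T \<alpha> = apex B"
  by auto

lemma susp_prj_alpha:
  "\<Sigma>a (prj1 B) \<cdot> \<Sigma>a \<alpha> = \<ominus> (\<Sigma>a v \<cdot> \<Sigma>a (prj1 A))"
  "\<Sigma>a (prj2 B) \<cdot> \<Sigma>a \<alpha> = (\<Sigma>a g \<cdot> \<Sigma>a (prj1 A)) \<boxplus> (\<Sigma>a u' \<cdot> \<Sigma>a (prj2 A))"
  by (subst susp_comp[symmetric]; simp)+

text \<open>Diagonal entries of the composites vanish because the two triangles are candidates. The
  lower left entries are differences that vanish by \<open>h v = v' g\<close>, by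
  \<open>w' h = \<Sigma>f w\<close> and by the suspended square, respectively.\<close>

lemma cone_candidate:
  assumes "completion T q h"
  shows "candidate_triangle T (\<alpha>, \<beta> h, \<gamma>)"
proof -
  note [simp] = assms[unfolded completion_iff]
  have hv: "h \<cdot> v = v' \<cdot> g" and wh: "w' \<cdot> h = \<Sigma>a f \<cdot> w" by auto
  have "\<beta> h \<cdot> \<alpha> = Zero T (apex A) (apex C)"
    by (rule bip_into_eqI[of "\<Sigma>o (Dom T u)" "Cod T v'"]) (simp_all add: comp_reassoc[OF hv])
  moreover have "\<gamma> \<cdot> \<beta> h = Zero T (apex B) (\<Sigma>o (apex A))"
    by (rule susp_bip_into_eqI[of "Cod T u" "Dom T u'"]) (simp_all add: comp_reassoc[OF wh])
  moreover have "\<Sigma>a \<alpha> \<cdot> \<gamma> = Zero T (apex C) (\<Sigma>o (apex B))"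
    by (rule susp_bip_into_eqI[of "Cod T v" "Cod T u'"])
      (simp_all add: susp_prj_alpha[THEN comp_reassoc] susp_square[THEN comp_reassoc])
  ultimately show ?thesis
    by (simp add: candidate_iff del: candidate_triangle.simps)
qed

text \<open>Distinguishedness of the cone becomes a system of equations for \<open>\<phi>\<close>.
  The same system describes the vanishing of the obstruction in
  \<open>obstruction_eq_one_iff\<close>.\<close>

lemma good_completion_iff:
  assumes E: "(\<alpha>, s, t) \<in> \<Delta>"
  shows "(\<exists>h. good_completion T \<Delta> q h) \<longleftrightarrow>
    (\<exists>\<phi>\<in>mor T (Cod T s) (apex C). (\<exists>h\<in>mor T (Cod T v) (Cod T v'). \<phi> \<cdot> s = \<beta> h) \<and> \<gamma> \<cdot> \<phi> = t)"
    (is "?l \<longleftrightarrow> ?r")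
proof
  note DE = distD[OF E, unfolded alpha_arr]
  note [simp] = DE
  show ?r if ?l
  proof -
    obtain h where h: "completion T q h" and D: "(\<alpha>, \<beta> h, \<gamma>) \<in> \<Delta>"
      using \<open>?l\<close> by (auto simp: good_completion_def Let_def simp del: completion.simps)
    note [simp] = distD[OF D]
    obtain \<phi> where "\<phi> \<in> Arr T" "Dom T \<phi> = Cod T s" "Cod T \<phi> = Cod T (\<beta> h)"
      "\<phi> \<cdot> s = \<beta> h \<cdot> Idt T (apex B)" "\<gamma> \<cdot> \<phi> = \<Sigma>a (Idt T (apex A)) \<cdot> t"
      by (rule triangle_map[OF E D, of "Idt T (apex A)" "Idt T (apex B)"]) simp_all
    then show ?r
      using h[unfolded completion_iff] by (auto simp: mor_def intro!: bexI[of _ \<phi>] bexI[of _ h])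
  qed
  show ?l if ?r
  proof -
    obtain \<phi> h where \<phi>: "\<phi> \<in> Arr T" "Dom T \<phi> = Cod T s" "Cod T \<phi> = apex C"
      and h: "h \<in> Arr T" "Dom T h = Cod T v" "Cod T h = Cod T v'"
      and s: "\<phi> \<cdot> s = \<beta> h" and t: "\<gamma> \<cdot> \<phi> = t"
      using \<open>?r\<close> by (auto simp: mor_def)
    note [simp] = \<phi> h
    \<comment> \<open>Here \<open>\<phi> s \<alpha>\<close> vanishes because
      \<open>s \<alpha>\<close> does; the lower left entry of this matrix equation says
      \<open>h v = v' g\<close>.\<close>
    have ba: "\<beta> h \<cdot> \<alpha> = Zero T (apex A) (apex C)"
      unfolding s[symmetric] by simp
    have "prj2 C \<cdot> (\<beta> h \<cdot> (\<alpha> \<cdot> inj1 A)) = prj2 C \<cdot> ((\<beta> h \<cdot> \<alpha>) \<cdot> inj1 A)"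
      by (simp del: prj_block_comp)
    then have hv: "h \<cdot> v = v' \<cdot> g"
      unfolding ba by (simp add: add_eq_zero_iff neg_inject)
    \<comment> \<open>Likewise \<open>\<gamma> \<phi> s = t s\<close> vanishes, and the lower left
      entry says \<open>w' h = \<Sigma>f w\<close>.\<close>
    have gb: "\<gamma> \<cdot> \<beta> h = Zero T (apex B) (\<Sigma>o (apex A))"
      unfolding s[symmetric] by (simp add: comp_reassoc[OF t])
    have "\<Sigma>a (prj2 A) \<cdot> (\<gamma> \<cdot> (\<beta> h \<cdot> inj1 B)) = \<Sigma>a (prj2 A) \<cdot> ((\<gamma> \<cdot> \<beta> h) \<cdot> inj1 B)"
      by (simp del: susp_prj_block_comp)
    then have wh: "w' \<cdot> h = \<Sigma>a f \<cdot> w"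
      unfolding gb by (simp add: add_eq_zero_iff neg_inject)
    have compl: "completion T q h" using hv wh by (simp add: completion_iff del: completion.simps)
    \<comment> \<open>For \<open>b = (z, y)\<close> the first row gives \<open>z = v y0\<close>. The
      second row then reads \<open>v' (g y0 + y) = 0\<close>, so the bracket is \<open>u' x\<close>,
      and \<open>(- y0, x)\<close> is the required preimage.\<close>
    have ex1: "hom_exact \<alpha> (\<beta> h)"
    proof (rule hom_exactI)
      fix b assume b: "b \<in> Arr T" "Cod T b = Cod T \<alpha>" and 0: "\<beta> h \<cdot> b = Zero T (Dom T b) (Cod T (\<beta> h))"
      have [simp]: "b \<in> Arr T" "Cod T b = apex B" using b by simp_all
      define z where "z = prj1 B \<cdot> b"
      define y where "y = prj2 B \<cdot> b"
      have zy [simp]: "z \<in> Arr T" "Dom T z = Dom T b" "Cod T z = Cod T v"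
        "y \<in> Arr T" "Dom T y = Dom T b" "Cod T y = Cod T u'" by (simp_all add: z_def y_def)
      have "w \<cdot> z = Zero T (Dom T z) (Cod T w)"
        using arg_cong[OF 0, of "Comp T (prj1 C)"] by (simp add: z_def)
      then obtain y0 where y0: "y0 \<in> Arr T" "Dom T y0 = Dom T b" "Cod T y0 = Cod T u" "v \<cdot> y0 = z"
        using hom_exactE[OF hom_exact_dist'(1)[OF D1], of z] by auto
      have "(h \<cdot> z) \<boxplus> (v' \<cdot> y) = Zero T (Dom T b) (Cod T v')"
        using arg_cong[OF 0, of "Comp T (prj2 C)"] by (simp add: z_def y_def)
      then have "v' \<cdot> ((g \<cdot> y0) \<boxplus> y) = Zero T (Dom T b) (Cod T v')"
        using y0(1-3) comp_reassoc[OF hv, of y0] unfolding y0(4)[symmetric] by simp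
      then obtain x where x: "x \<in> Arr T" "Dom T x = Dom T b" "Cod T x = Dom T u'"
          "u' \<cdot> x = (g \<cdot> y0) \<boxplus> y"
        using hom_exactE[OF hom_exact_dist[OF D2], of "(g \<cdot> y0) \<boxplus> y"] y0 by auto
      define a where "a = (inj1 A \<cdot> \<ominus> y0) \<boxplus> (inj2 A \<cdot> x)"
      have a: "a \<in> Arr T" "Dom T a = Dom T b" "Cod T a = apex A"
        using x y0 by (simp_all add: a_def)
      have pa: "prj1 A \<cdot> a = \<ominus> y0" "prj2 A \<cdot> a = x"
        using x y0 by (simp_all add: a_def)
      have "\<alpha> \<cdot> a = b"
        by (rule bip_into_eqI[of "Cod T v" "Cod T u'"]) (use a x y0 in \<open>simp_all add: pa z_def y_def\<close>)
      then show "\<exists>x\<in>Arr T. Dom T x = Dom T b \<and> Cod T x = Dom T \<alpha> \<and> \<alpha> \<cdot> x = b"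
        using a by (intro bexI[of _ a]) simp_all
    qed
    \<comment> \<open>The same chase one place further: the first row gives \<open>a = w z0\<close>,
      the second \<open>h z0 + z = v' y\<close>, and the preimage is
      \<open>(- z0, y)\<close>.\<close>
    have ex2: "hom_exact (\<beta> h) \<gamma>"
    proof (rule hom_exactI)
      fix c assume c: "c \<in> Arr T" "Cod T c = Cod T (\<beta> h)" and 0: "\<gamma> \<cdot> c = Zero T (Dom T c) (Cod T \<gamma>)"
      have [simp]: "c \<in> Arr T" "Cod T c = apex C" using c by simp_all
      define a where "a = prj1 C \<cdot> c"
      define z where "z = prj2 C \<cdot> c"
      have az [simp]: "z \<in> Arr T" "Dom T z = Dom T c" "Cod T z = Cod T v'"
        "a \<in> Arr T" "Dom T a = Dom T c" "Cod T a = \<Sigma>o (Dom T u)" by (simp_all add: z_def a_def)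
      have "\<Sigma>a u \<cdot> a = Zero T (Dom T a) (\<Sigma>o (Cod T u))"
        using arg_cong[OF 0, of "Comp T (\<Sigma>a (prj1 A))"] by (simp add: a_def)
      then obtain z0 where z0: "z0 \<in> Arr T" "Dom T z0 = Dom T c" "Cod T z0 = Cod T v" "w \<cdot> z0 = a"
        using hom_exactE[OF hom_exact_dist'(2)[OF D1], of a] by auto
      have "(\<Sigma>a f \<cdot> a) \<boxplus> (w' \<cdot> z) = Zero T (Dom T c) (\<Sigma>o (Dom T u'))"
        using arg_cong[OF 0, of "Comp T (\<Sigma>a (prj2 A))"] by (simp add: z_def a_def)
      then have "w' \<cdot> ((h \<cdot> z0) \<boxplus> z) = Zero T (Dom T c) (\<Sigma>o (Dom T u'))"
        using z0(1-3) comp_reassoc[OF wh, of z0] unfolding z0(4)[symmetric] by simp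
      then obtain y where y: "y \<in> Arr T" "Dom T y = Dom T c" "Cod T y = Cod T u'"
          "v' \<cdot> y = (h \<cdot> z0) \<boxplus> z"
        using hom_exactE[OF hom_exact_dist'(1)[OF D2], of "(h \<cdot> z0) \<boxplus> z"] z0 by auto
      define b where "b = (inj1 B \<cdot> \<ominus> z0) \<boxplus> (inj2 B \<cdot> y)"
      have b: "b \<in> Arr T" "Dom T b = Dom T c" "Cod T b = apex B"
        using y z0 by (simp_all add: b_def)
      have pb: "prj1 B \<cdot> b = \<ominus> z0" "prj2 B \<cdot> b = y"
        using y z0 by (simp_all add: b_def)
      have "\<beta> h \<cdot> b = c"
        by (rule bip_into_eqI[of "\<Sigma>o (Dom T u)" "Cod T v'"])
          (use b y z0 in \<open>simp_all add: pb z_def a_def\<close>)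
      then show "\<exists>x\<in>Arr T. Dom T x = Dom T c \<and> Cod T x = Dom T (\<beta> h) \<and> \<beta> h \<cdot> x = c"
        using b by (intro bexI[of _ b]) simp_all
    qed
    have "(\<alpha>, \<beta> h, \<gamma>) \<in> \<Delta>"
      by (rule distinguishedI[OF cone_candidate[OF compl] ex1 ex2 E, of \<phi>]) (simp_all add: s t)
    then show ?l
      using compl by (auto simp: good_completion_def Let_def simp del: completion.simps)
  qed
qed

text \<open>A class in a cokernel is trivial exactly when its representative lies in the image. What
  remains is to read the equation modulo \<open>J\<close> as the freedom to choose
  \<open>h\<close>.\<close>

lemma obstruction_eq_one_iff:
  assumes E: "(\<alpha>, s, t) \<in> \<Delta>"
  shows "obstruction T q (s, t) = \<one>\<^bsub>Obs T q (s, t)\<^esub> \<longleftrightarrow>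
    (\<exists>\<phi>\<in>mor T (Cod T s) (apex C). (\<exists>h\<in>mor T (Cod T v) (Cod T v'). \<phi> \<cdot> s = \<beta> h) \<and> \<gamma> \<cdot> \<phi> = t)"
proof -
  note [simp] = distD[OF E, unfolded alpha_arr]
  let ?H = "hom_group T (apex B) (apex C)" and ?K = "hom_group T (Cod T s) (\<Sigma>o (apex A))"
    and ?D = "hom_group T (Cod T s) (apex C)"
  let ?j = "\<lambda>a. block T B C (Zero T (Cod T v) (\<Sigma>o (Dom T u))) (Zero T (Cod T u') (\<Sigma>o (Dom T u)))
    a (Zero T (Cod T u') (Cod T v'))"
  define J where "J = ?j ` mor T (Cod T v) (Cod T v')"
  have J: "cone_J T q = J" by (auto simp: J_def)
  interpret H: comm_group ?H by (rule hom_comm_group) simp_all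
  interpret K: comm_group ?K by (rule hom_comm_group) simp_all
  interpret D: comm_group ?D by (rule hom_comm_group) simp_all
  have subJ: "subgroup J ?H"
  proof (rule H.subgroupI)
    show "J \<subseteq> carrier ?H" by (auto simp: J_def hom_group_simps mor_def)
    show "J \<noteq> {}" using zero_mor[of "Cod T v" "Cod T v'"] by (auto simp: J_def)
    show "inv\<^bsub>?H\<^esub> x \<in> J" if "x \<in> J" for x
    proof -
      obtain a where a: "a \<in> Arr T" "Dom T a = Cod T v" "Cod T a = Cod T v'" "x = ?j a"
        using \<open>x \<in> J\<close> by (auto simp: J_def mor_def)
      have "inv\<^bsub>?H\<^esub> x = \<ominus> x" using a by (subst neg_eq[of "apex B" "apex C"]) (auto simp: mor_def)
      also have "\<dots> = ?j (\<ominus> a)" using a by (simp add: block_neg)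
      finally show ?thesis using a by (auto simp: J_def mor_def)
    qed
    show "x \<otimes>\<^bsub>?H\<^esub> y \<in> J" if "x \<in> J" "y \<in> J" for x y
    proof -
      obtain a b where a: "a \<in> Arr T" "Dom T a = Cod T v" "Cod T a = Cod T v'" "x = ?j a"
        and b: "b \<in> Arr T" "Dom T b = Cod T v" "Cod T b = Cod T v'" "y = ?j b"
        using \<open>x \<in> J\<close> \<open>y \<in> J\<close> by (auto simp: J_def mor_def)
      have "x \<boxplus> y = ?j (a \<boxplus> b)" using a b by (simp add: block_add)
      then show ?thesis using a b by (auto simp: J_def mor_def hom_group_simps)
    qed
  qed
  then have nJ: "J \<lhd> ?H" by (rule H.subgroup_imp_normal)
  interpret J: normal J ?H by (rule nJ)
  let ?G = "(?H Mod J) \<times>\<times> ?K"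
  interpret G: group ?G by (rule DirProd_group[OF J.factorgroup_is_group]) (rule K.is_group)
  have cod: "delta_cod T q (s, t) = ?G" and dom: "delta_dom T q (s, t) = ?D" and BC: "hom_BC T q = ?H"
    unfolding delta_cod_def J by (simp_all add: delta_dom_def hom_BC_def)
  let ?d = "delta T q (s, t)"
  have d: "?d \<phi> = (J #>\<^bsub>?H\<^esub> (\<phi> \<cdot> s), \<gamma> \<cdot> \<phi>)" for \<phi>
    unfolding delta_def J BC by (simp add: Let_def)
  \<comment> \<open>That \<delta> is a homomorphism makes its image a subgroup, as needed to
    identify triviality of a coset with membership.\<close>
  have hom: "?d \<in> hom ?D ?G"
  proof (rule homI)
    fix x assume "x \<in> carrier ?D"
    then show "?d x \<in> carrier ?G"
      unfolding d by (auto simp: DirProd_def FactGroup_def RCOSETS_def hom_group_simps mor_def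
          intro!: exI[of _ "x \<cdot> s"])
  next
    fix x y assume "x \<in> carrier ?D" "y \<in> carrier ?D"
    then have [simp]: "x \<in> Arr T" "Dom T x = Cod T s" "Cod T x = apex C"
      "y \<in> Arr T" "Dom T y = Cod T s" "Cod T y = apex C"
      by (auto simp: hom_group_simps mor_def)
    have "(J #>\<^bsub>?H\<^esub> (x \<cdot> s)) <#>\<^bsub>?H\<^esub> (J #>\<^bsub>?H\<^esub> (y \<cdot> s)) = J #>\<^bsub>?H\<^esub> ((x \<cdot> s) \<otimes>\<^bsub>?H\<^esub> (y \<cdot> s))"
      by (rule J.rcos_sum) (auto simp: hom_group_simps mor_def)
    then show "?d (x \<otimes>\<^bsub>?D\<^esub> y) = ?d x \<otimes>\<^bsub>?G\<^esub> ?d y"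
      unfolding d by (simp add: DirProd_def FactGroup_def hom_group_simps)
  qed
  interpret d: group_hom ?D ?G ?d
    by (rule group_hom.intro) (auto intro: group_hom_axioms.intro hom)
  have sub: "subgroup (?d ` carrier ?D) ?G" by (rule d.img_is_subgroup)
  let ?b0 = "\<beta> (Zero T (Cod T v) (Cod T v'))"
  let ?x = "(J #>\<^bsub>?H\<^esub> ?b0, t)"
  have x: "?x \<in> carrier ?G"
    by (auto simp: DirProd_def FactGroup_def RCOSETS_def hom_group_simps mor_def
        intro!: exI[of _ ?b0])
  \<comment> \<open>Adding elements of \<open>J\<close> fills the zero entry of
    \<open>\<beta>_0\<close> arbitrarily, so the coset of \<open>\<beta>_0\<close> is the set of all
    \<open>\<beta> h\<close>.\<close>
  have J_beta: "J #>\<^bsub>?H\<^esub> ?b0 = \<beta> ` mor T (Cod T v) (Cod T v')"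
  proof -
    have "?j a \<boxplus> ?b0 = \<beta> a" if "a \<in> mor T (Cod T v) (Cod T v')" for a
      using that by (subst block_add) (auto simp: mor_def)
    then show ?thesis by (auto simp: r_coset_def J_def hom_group_simps)
  qed
  have "obstruction T q (s, t) = (?d ` carrier ?D) #>\<^bsub>?G\<^esub> ?x"
    unfolding obstruction_def cod dom BC J by (simp add: Let_def)
  moreover have "\<one>\<^bsub>Obs T q (s, t)\<^esub> = ?d ` carrier ?D"
    unfolding Obs_def cod dom by (simp add: FactGroup_def)
  moreover have "(?d ` carrier ?D) #>\<^bsub>?G\<^esub> ?x = ?d ` carrier ?D \<longleftrightarrow> ?x \<in> ?d ` carrier ?D"
    using G.coset_join1[OF _ x sub] G.coset_join2[OF x sub] subgroup.subset[OF sub] by blast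
  moreover have "?x = ?d \<phi> \<longleftrightarrow> (\<exists>h\<in>mor T (Cod T v) (Cod T v'). \<phi> \<cdot> s = \<beta> h) \<and> \<gamma> \<cdot> \<phi> = t"
    if "\<phi> \<in> mor T (Cod T s) (apex C)" for \<phi>
  proof -
    have c: "\<phi> \<cdot> s \<in> carrier ?H" "?b0 \<in> carrier ?H"
      using that by (auto simp: hom_group_simps mor_def)
    have "J #>\<^bsub>?H\<^esub> ?b0 = J #>\<^bsub>?H\<^esub> (\<phi> \<cdot> s) \<longleftrightarrow> \<phi> \<cdot> s \<in> J #>\<^bsub>?H\<^esub> ?b0"
      using H.repr_independence[OF _ c(2) subJ] H.rcos_self[OF c(1) subJ] by auto
    then show ?thesis unfolding d J_beta by auto
  qed
  ultimately show ?thesis by (auto simp: image_iff hom_group_simps)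
qed

end

section \<open>The octahedral axiom\<close>

context pretriangulated
begin

text \<open>The left vertical arrow is an identity, so X and \<Sigma>X can be removed from the cone
  of the square. The middle object F + Z is kept as it is; Y is a retract of Y + X and H a retract
  of \<Sigma>X + H.\<close>

lemma homotopy_cartesian:
  assumes D1: "(f, a, b) \<in> \<Delta>" and D2: "(e, c, d) \<in> \<Delta>"
    and g: "g \<in> Arr T" "Dom T g = Cod T f" and gf: "g \<cdot> f = e"
    and good: "good_completion T \<Delta> ((f, a, b), (e, c, d), Idt T (Dom T f), g) h"
  defines "M \<equiv> Bip T (Cod T a) (Cod T g)"
  shows "((inj1 M \<cdot> \<ominus> a) \<boxplus> (inj2 M \<cdot> g), (h \<cdot> prj1 M) \<boxplus> (c \<cdot> prj2 M), \<Sigma>a f \<cdot> d) \<in> \<Delta>"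
proof -
  have e: "Cod T e = Cod T g" "Dom T e = Dom T f" using g distD[OF D1] gf by auto
  have "initial_square T \<Delta> ((f, a, b), (e, c, d), Idt T (Dom T f), g)"
    using D1 D2 g gf e distD(1-3)[OF D1] distD(1-3)[OF D2] by (auto simp: mor_def)
  then interpret S: square T \<Delta> f a b e c d "Idt T (Dom T f)" g
    by unfold_locales
  note [simp] = g e(2)
  have M: "M = S.B" by (simp add: M_def)
  have compl: "completion T S.q h" and D: "(S.\<alpha>, S.\<beta> h, S.\<gamma>) \<in> \<Delta>"
    using good by (auto simp: good_completion_def Let_def simp del: completion.simps)
  have h [simp]: "h \<in> Arr T" "Dom T h = Cod T a" "Cod T h = Cod T c"
    and ha: "h \<cdot> a = c \<cdot> g" and dh: "d \<cdot> h = b"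
    using compl unfolding S.completion_iff by auto
  note re = comp_reassoc[OF ha] comp_reassoc[OF dh] comp_reassoc[OF gf] ha dh gf
  have sef: "\<Sigma>a e = \<Sigma>a g \<cdot> \<Sigma>a f" using gf g by auto
  have sgf: "\<Sigma>a g \<cdot> (\<Sigma>a f \<cdot> d) = Zero T (Cod T c) (\<Sigma>o (Cod T g))"
    using distD(9)[OF D2] unfolding sef by simp
  let ?k1 = "(inj1 S.B \<cdot> \<ominus> a) \<boxplus> (inj2 S.B \<cdot> g)"
  let ?k2 = "(h \<cdot> prj1 S.B) \<boxplus> (c \<cdot> prj2 S.B)"
  \<comment> \<open>The component \<open>\<ominus> d\<close> makes the second row of
    \<open>S.\<gamma> \<cdot> ?i3\<close> equal to \<open>- d + d = 0\<close>; the plain inclusion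
    of H would fail here.\<close>
  let ?i3 = "(inj1 S.C \<cdot> \<ominus> d) \<boxplus> inj2 S.C"
  \<comment> \<open>The entry \<open>f\<close> is forced: \<open>S.\<alpha>\<close> restricted to X
    is \<open>(0, e)\<close>, which equals \<open>?k1 \<cdot> f\<close> because
    \<open>a f = 0\<close> and \<open>g f = e\<close>.\<close>
  let ?p1 = "prj1 S.A \<boxplus> (f \<cdot> prj2 S.A)"
  show ?thesis
    unfolding M
  proof (rule retract_distinguished[OF _ D])
    show "candidate_triangle T (?k1, ?k2, \<Sigma>a f \<cdot> d)"
      by (simp add: candidate_iff re sgf del: candidate_triangle.simps)
    show "triangle_morphism T (?k1, ?k2, \<Sigma>a f \<cdot> d) (S.\<alpha>, S.\<beta> h, S.\<gamma>)
        (inj1 S.A) (Idt T (apex S.B)) ?i3"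
    proof -
      have "?k1 = S.\<alpha> \<cdot> inj1 S.A"
        by (rule bip_into_eqI[of "Cod T a" "Cod T e"]) simp_all
      moreover have "?i3 \<cdot> ?k2 = S.\<beta> h"
        by (rule bip_into_eqI[of "\<Sigma>o (Dom T f)" "Cod T c"]) (simp_all add: re)
      moreover have "S.\<gamma> \<cdot> ?i3 = \<Sigma>a (inj1 S.A) \<cdot> (\<Sigma>a f \<cdot> d)"
        by (rule susp_bip_into_eqI[of "Cod T f" "Dom T f"]) simp_all
      ultimately show ?thesis by (auto simp: mor_def)
    qed
    show "triangle_morphism T (S.\<alpha>, S.\<beta> h, S.\<gamma>) (?k1, ?k2, \<Sigma>a f \<cdot> d)
        ?p1 (Idt T (apex S.B)) (prj2 S.C)"
    proof -
      have "S.\<alpha> = ?k1 \<cdot> ?p1"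
        by (rule bip_into_eqI[of "Cod T a" "Cod T e"]) (simp_all add: re)
      moreover have "(\<Sigma>a f \<cdot> d) \<cdot> prj2 S.C = \<Sigma>a ?p1 \<cdot> S.\<gamma>"
        by simp
      ultimately show ?thesis by (auto simp: mor_def)
    qed
    show "?p1 \<cdot> inj1 S.A = Idt T (Dom T ?k1)" "Idt T (apex S.B) \<cdot> Idt T (apex S.B) = Idt T (Cod T ?k1)"
      "prj2 S.C \<cdot> ?i3 = Idt T (Cod T ?k2)"
      by simp_all
  qed
qed

text \<open>The hypothesis supplies a good completion for just one choice of triangles. The result
  is carried to the prescribed triangles by the isomorphisms of cones over \<open>f\<close> and over
  \<open>e\<close>.\<close>

lemma homotopy_cartesian_exists:
  assumes GC: "\<And>f g. f \<in> Arr T \<Longrightarrow> g \<in> Arr T \<Longrightarrow> Cod T f = Dom T g \<Longrightarrow>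
      \<exists>q h. comp_square T \<Delta> g f q \<and> good_completion T \<Delta> q h"
    and D1: "(f, a, b) \<in> \<Delta>" and D2: "(e, c, d) \<in> \<Delta>"
    and g: "g \<in> Arr T" "Dom T g = Cod T f" and gf: "g \<cdot> f = e"
  defines "M \<equiv> Bip T (Cod T a) (Cod T g)"
  obtains h where "h \<in> mor T (Cod T a) (Cod T c)" "h \<cdot> a = c \<cdot> g" "d \<cdot> h = b"
    "((inj1 M \<cdot> \<ominus> a) \<boxplus> (inj2 M \<cdot> g), (h \<cdot> prj1 M) \<boxplus> (c \<cdot> prj2 M), \<Sigma>a f \<cdot> d) \<in> \<Delta>"
proof -
  obtain a0 b0 c0 d0 h0 where D01: "(f, a0, b0) \<in> \<Delta>" and D02: "(e, c0, d0) \<in> \<Delta>"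
    and good: "good_completion T \<Delta> ((f, a0, b0), (e, c0, d0), Idt T (Dom T f), g) h0"
    using GC[of f g] distD(1)[OF D1] g gf unfolding comp_square_def by (metis (no_types, lifting))
  define N where "N = Bip T (Cod T a0) (Cod T g)"
  have H: "((inj1 N \<cdot> \<ominus> a0) \<boxplus> (inj2 N \<cdot> g), (h0 \<cdot> prj1 N) \<boxplus> (c0 \<cdot> prj2 N), \<Sigma>a f \<cdot> d0) \<in> \<Delta>"
    unfolding N_def by (rule homotopy_cartesian[OF D01 D02 g gf good])
  note [simp] = distD[OF D1] distD[OF D2] distD[OF D01] distD[OF D02] susp_distD[OF D1]
  have e: "Cod T e = Cod T g" "Dom T e = Dom T f" using g gf by auto
  note [simp] = g e
  have compl: "completion T ((f, a0, b0), (e, c0, d0), Idt T (Dom T f), g) h0"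
    using good by (simp add: good_completion_def del: completion.simps)
  then have h0 [simp]: "h0 \<in> Arr T" "Dom T h0 = Cod T a0" "Cod T h0 = Cod T c0"
    and h0a: "h0 \<cdot> a0 = c0 \<cdot> g" and dh0: "d0 \<cdot> h0 = b0"
    by (simp_all add: mor_def)
  obtain \<phi> \<phi>' where \<phi>: "\<phi> \<in> mor T (Cod T a) (Cod T a0)" "\<phi>' \<in> mor T (Cod T a0) (Cod T a)"
    "\<phi> \<cdot> \<phi>' = Idt T (Cod T a0)" "\<phi>' \<cdot> \<phi> = Idt T (Cod T a)" "\<phi> \<cdot> a = a0" "b0 \<cdot> \<phi> = b" "\<phi>' \<cdot> a0 = a"
    by (rule distinguished_unique[OF D1 D01])
  obtain \<psi> \<psi>' where \<psi>: "\<psi> \<in> mor T (Cod T c0) (Cod T c)" "\<psi>' \<in> mor T (Cod T c) (Cod T c0)"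
    "\<psi> \<cdot> \<psi>' = Idt T (Cod T c)" "\<psi>' \<cdot> \<psi> = Idt T (Cod T c0)" "\<psi> \<cdot> c0 = c" "d \<cdot> \<psi> = d0" "\<psi>' \<cdot> c = c0" "d0 \<cdot> \<psi>' = d"
    by (rule distinguished_unique[OF D02 D2])
  have [simp]: "\<phi> \<in> Arr T" "Dom T \<phi> = Cod T a" "Cod T \<phi> = Cod T a0"
    "\<phi>' \<in> Arr T" "Dom T \<phi>' = Cod T a0" "Cod T \<phi>' = Cod T a"
    "\<psi> \<in> Arr T" "Dom T \<psi> = Cod T c0" "Cod T \<psi> = Cod T c"
    "\<psi>' \<in> Arr T" "Dom T \<psi>' = Cod T c" "Cod T \<psi>' = Cod T c0"
    using \<phi>(1,2) \<psi>(1,2) by (auto simp: mor_def)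
  note eqs = \<phi>(3-) \<psi>(3-) h0a dh0 gf
  note re = eqs eqs[THEN comp_reassoc]
  define h where "h = \<psi> \<cdot> (h0 \<cdot> \<phi>)"
  have h [simp]: "h \<in> Arr T" "Dom T h = Cod T a" "Cod T h = Cod T c"
    by (simp_all add: h_def)
  have ha: "h \<cdot> a = c \<cdot> g" and dh: "d \<cdot> h = b"
    by (simp_all add: h_def re)
  have "\<Sigma>a e = \<Sigma>a g \<cdot> \<Sigma>a f" using gf g by auto
  then have sgf: "\<Sigma>a g \<cdot> (\<Sigma>a f \<cdot> d) = Zero T (Cod T c) (\<Sigma>o (Cod T g))"
    using distD(9)[OF D2] by simp
  let ?k1 = "(inj1 M \<cdot> \<ominus> a) \<boxplus> (inj2 M \<cdot> g)"
  let ?k2 = "(h \<cdot> prj1 M) \<boxplus> (c \<cdot> prj2 M)"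
  let ?l1 = "(inj1 N \<cdot> \<ominus> a0) \<boxplus> (inj2 N \<cdot> g)"
  let ?l2 = "(h0 \<cdot> prj1 N) \<boxplus> (c0 \<cdot> prj2 N)"
  \<comment> \<open>The transport is diagonal, \<open>\<phi>\<close> on the cone of \<open>f\<close>
    and the identity on the target of \<open>g\<close>. It is fed to the retract criterion, with
    \<open>?p2\<close> as its inverse.\<close>
  let ?i2 = "block T M N \<phi> (Zero T (Cod T g) (Cod T a0)) (Zero T (Cod T a) (Cod T g)) (Idt T (Cod T g))"
  let ?p2 = "block T N M \<phi>' (Zero T (Cod T g) (Cod T a)) (Zero T (Cod T a0) (Cod T g)) (Idt T (Cod T g))"
  have "(?k1, ?k2, \<Sigma>a f \<cdot> d) \<in> \<Delta>"
  proof (rule retract_distinguished[OF _ H])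
    show "candidate_triangle T (?k1, ?k2, \<Sigma>a f \<cdot> d)"
      by (simp add: candidate_iff M_def ha dh comp_reassoc[OF ha] comp_reassoc[OF dh] sgf
          del: candidate_triangle.simps)
    show "triangle_morphism T (?k1, ?k2, \<Sigma>a f \<cdot> d) (?l1, ?l2, \<Sigma>a f \<cdot> d0) (Idt T (Cod T f)) ?i2 \<psi>'"
    proof -
      have "?i2 \<cdot> ?k1 = ?l1"
        unfolding M_def N_def
        by (rule bip_into_eqI[of "Cod T a0" "Cod T g"]) (simp_all add: re)
      moreover have "\<psi>' \<cdot> ?k2 = ?l2 \<cdot> ?i2"
        unfolding M_def N_def by (simp add: re h_def)
      ultimately show ?thesis by (auto simp: mor_def M_def N_def re)
    qed
    show "triangle_morphism T (?l1, ?l2, \<Sigma>a f \<cdot> d0) (?k1, ?k2, \<Sigma>a f \<cdot> d) (Idt T (Cod T f)) ?p2 \<psi>"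
    proof -
      have "?p2 \<cdot> ?l1 = ?k1"
        unfolding M_def N_def
        by (rule bip_into_eqI[of "Cod T a" "Cod T g"]) (simp_all add: re)
      moreover have "\<psi> \<cdot> ?l2 = ?k2 \<cdot> ?p2"
        unfolding M_def N_def by (simp add: re h_def)
      ultimately show ?thesis by (auto simp: mor_def M_def N_def re)
    qed
    show "Idt T (Cod T f) \<cdot> Idt T (Cod T f) = Idt T (Dom T ?k1)" "\<psi> \<cdot> \<psi>' = Idt T (Cod T ?k2)"
      by (simp_all add: M_def re)
    show "?p2 \<cdot> ?i2 = Idt T (Cod T ?k1)"
      unfolding M_def N_def
      by (rule bip_into_eqI[of "Cod T a" "Cod T g"]) (simp_all add: re)
  qed
  then show thesis using ha dh by (intro that[of h]) (simp_all add: mor_def)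
qed

text \<open>Two homotopy cartesian triangles are produced, one for \<open>v \<cdot> u\<close> and
  one for a factorization of \<open>v\<close> through the middle term of the first. The octahedral
  triangle is a retract of the second.\<close>

lemma TR4_if_good_completions:
  assumes GC: "\<And>f g. f \<in> Arr T \<Longrightarrow> g \<in> Arr T \<Longrightarrow> Cod T f = Dom T g \<Longrightarrow>
      \<exists>q h. comp_square T \<Delta> g f q \<and> good_completion T \<Delta> q h"
  shows "TR4 T \<Delta>"
  unfolding TR4_def
proof (intro allI impI, elim conjE)
  fix u v i i' j j' k k'
  assume uv: "Cod T u = Dom T v" and Du: "(u, i, i') \<in> \<Delta>" and Dv: "(v, j, j') \<in> \<Delta>"
    and Dvu: "(v \<cdot> u, k, k') \<in> \<Delta>"
  note [simp] = distD[OF Du] distD[OF Dv] susp_distD[OF Dv]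
  have vu [simp]: "Dom T v = Cod T u" "Dom T (v \<cdot> u) = Dom T u" "Cod T (v \<cdot> u) = Cod T v"
    using uv by simp_all
  note [simp] = distD(2-8)[OF Dvu, unfolded vu]
  define M where "M = Bip T (Cod T i) (Cod T v)"
  \<comment> \<open>This \<open>h\<close> will be the octahedral map \<open>u'\<close>.\<close>
  obtain h where "h \<in> mor T (Cod T i) (Cod T k)" and hi: "h \<cdot> i = k \<cdot> v" and kh: "k' \<cdot> h = i'"
    and H: "((inj1 M \<cdot> \<ominus> i) \<boxplus> (inj2 M \<cdot> v), (h \<cdot> prj1 M) \<boxplus> (k \<cdot> prj2 M), \<Sigma>a u \<cdot> k') \<in> \<Delta>"
    unfolding M_def
    by (rule homotopy_cartesian_exists[OF GC Du Dvu, of v]) simp_all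
  then have h [simp]: "h \<in> Arr T" "Dom T h = Cod T i" "Cod T h = Cod T k"
    by (simp_all add: mor_def)
  define k1 where "k1 = (inj1 M \<cdot> \<ominus> i) \<boxplus> (inj2 M \<cdot> v)"
  define k2 where "k2 = (h \<cdot> prj1 M) \<boxplus> (k \<cdot> prj2 M)"
  have k1 [simp]: "k1 \<in> Arr T" "Dom T k1 = Cod T u" "Cod T k1 = apex M"
    and k2 [simp]: "k2 \<in> Arr T" "Dom T k2 = apex M" "Cod T k2 = Cod T k"
    by (simp_all add: k1_def k2_def M_def)
  define N where "N = Bip T (Cod T k) (Cod T v)"
  have M [simp]: "prj2 M \<in> Arr T" "Dom T (prj2 M) = apex M" "Cod T (prj2 M) = Cod T v"
    by (simp_all add: M_def)
  have prj2_k1: "prj2 M \<cdot> k1 = v" by (simp add: k1_def M_def)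
  \<comment> \<open>Now \<open>v\<close> is factored as \<open>prj2 M \<cdot> k1\<close>. The
    triangle on \<open>k1\<close> is the one just found, and the prescribed triangle on
    \<open>v\<close> serves for the composite.\<close>
  obtain v' where "v' \<in> mor T (Cod T k2) (Cod T j)" and vk2: "v' \<cdot> k2 = j \<cdot> prj2 M"
    and jv: "j' \<cdot> v' = \<Sigma>a u \<cdot> k'"
    and K: "((inj1 N \<cdot> \<ominus> k2) \<boxplus> (inj2 N \<cdot> prj2 M), (v' \<cdot> prj1 N) \<boxplus> (j \<cdot> prj2 N), \<Sigma>a k1 \<cdot> j') \<in> \<Delta>"
    by (rule homotopy_cartesian_exists[OF GC H[folded k1_def k2_def] Dv, of "prj2 M"])
      (simp_all add: prj2_k1 N_def)
  then have v' [simp]: "v' \<in> Arr T" "Dom T v' = Cod T k" "Cod T v' = Cod T j"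
    by (simp_all add: mor_def)
  \<comment> \<open>The two components of \<open>v' \<cdot> k2 = j \<cdot> prj2 M\<close> are
    \<open>v' h = 0\<close> and \<open>v' k = j\<close>.\<close>
  have "v' \<cdot> (k2 \<cdot> inj1 M) = (j \<cdot> prj2 M) \<cdot> inj1 M"
    unfolding vk2[symmetric] by (simp add: M_def k2_def)
  then have vh: "v' \<cdot> h = Zero T (Cod T i) (Cod T j)" by (simp add: k2_def M_def)
  have "v' \<cdot> (k2 \<cdot> inj2 M) = (j \<cdot> prj2 M) \<cdot> inj2 M"
    unfolding vk2[symmetric] by (simp add: M_def k2_def)
  then have vk: "v' \<cdot> k = j" by (simp add: k2_def M_def)
  note eqs = hi kh jv vh vk
  have "\<Sigma>a h \<cdot> \<Sigma>a i = \<Sigma>a k \<cdot> \<Sigma>a v" using arg_cong[OF hi, of "\<Sigma>a"] by simp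
  note re = eqs eqs[THEN comp_reassoc] this[THEN comp_reassoc]
  \<comment> \<open>The second component disappears since \<open>\<Sigma>v j' = 0\<close>. The
    remaining sign is absorbed by using \<open>\<ominus> (inj1 M)\<close> and
    \<open>\<ominus> (prj1 M)\<close> in the retraction.\<close>
  have susp_k1: "\<Sigma>a k1 \<cdot> j' = \<ominus> (\<Sigma>a (inj1 M) \<cdot> (\<Sigma>a i \<cdot> j'))"
    by (simp add: k1_def M_def)
  let ?l1 = "(inj1 N \<cdot> \<ominus> k2) \<boxplus> (inj2 N \<cdot> prj2 M)"
  let ?l2 = "(v' \<cdot> prj1 N) \<boxplus> (j \<cdot> prj2 N)"
  \<comment> \<open>The entry \<open>k\<close> cancels the \<open>k\<close>-part of
    \<open>\<ominus> k2\<close>, leaving \<open>- h \<cdot> prj1 M\<close> in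
    \<open>?p2 \<cdot> ?l1\<close>; it is also compatible with the third map because
    \<open>v' k = j\<close>.\<close>
  let ?p2 = "prj1 N \<boxplus> (k \<cdot> prj2 N)"
  have susp_ui: "\<Sigma>a i \<cdot> (\<Sigma>a u \<cdot> k') = Zero T (Cod T k) (\<Sigma>o (Cod T i))"
    using susp_distD(2)[OF Du, of k'] by simp
  have "(h, v', \<Sigma>a i \<cdot> j') \<in> \<Delta>"
  proof (rule retract_distinguished[OF _ K])
    show "candidate_triangle T (h, v', \<Sigma>a i \<cdot> j')"
      by (simp add: candidate_iff re susp_ui del: candidate_triangle.simps)
    show "triangle_morphism T (h, v', \<Sigma>a i \<cdot> j') (?l1, ?l2, \<Sigma>a k1 \<cdot> j')
        (\<ominus> (inj1 M)) (inj1 N) (Idt T (Cod T j))"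
    proof -
      have "inj1 N \<cdot> h = ?l1 \<cdot> \<ominus> (inj1 M)"
        unfolding N_def
        by (rule bip_into_eqI[of "Cod T k" "Cod T v"]) (simp_all add: k2_def M_def)
      moreover have "v' = ?l2 \<cdot> inj1 N" by (simp add: N_def)
      ultimately show ?thesis by (simp add: mor_def susp_k1) (simp add: M_def N_def)
    qed
    show "triangle_morphism T (?l1, ?l2, \<Sigma>a k1 \<cdot> j') (h, v', \<Sigma>a i \<cdot> j')
        (\<ominus> (prj1 M)) ?p2 (Idt T (Cod T j))"
    proof -
      have "?p2 \<cdot> ?l1 = h \<cdot> \<ominus> (prj1 M)"
        by (simp add: N_def k2_def) (simp add: M_def add_ac)
      moreover have "?l2 = v' \<cdot> ?p2" by (simp add: N_def re)
      moreover have "\<Sigma>a i \<cdot> j' = \<Sigma>a (\<ominus> (prj1 M)) \<cdot> (\<Sigma>a k1 \<cdot> j')"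
        unfolding susp_k1 by (simp add: M_def)
      ultimately show ?thesis by (simp add: mor_def) (simp add: M_def N_def)
    qed
    show "\<ominus> (prj1 M) \<cdot> \<ominus> (inj1 M) = Idt T (Dom T h)" "?p2 \<cdot> inj1 N = Idt T (Cod T h)"
      "Idt T (Cod T j) \<cdot> Idt T (Cod T j) = Idt T (Cod T v')"
      by (simp_all add: M_def N_def)
  qed
  then show "\<exists>u'\<in>mor T (Cod T i) (Cod T k). \<exists>v'\<in>mor T (Cod T k) (Cod T j).
           u' \<cdot> i = k \<cdot> v \<and> v' \<cdot> k = j \<and>
           k' \<cdot> u' = i' \<and> j' \<cdot> v' = \<Sigma>a u \<cdot> k' \<and> (u', v', \<Sigma>a i \<cdot> j') \<in> \<Delta>"
    using hi kh jv vk by (intro bexI[of _ h] bexI[of _ v'] conjI) (simp_all add: mor_def)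
qed

end

section \<open>From TR4 to the vanishing of the obstruction\<close>

context square
begin

abbreviation "M \<equiv> Bip T (Cod T u) (Cod T u')"
text \<open>Up to a shear automorphism of Y + Y', \<open>P\<close> is the direct sum of the identity
  of Y and \<open>u'\<close>; \<open>Q\<close> is the direct sum of \<open>- v\<close> and the
  identity of Y'. Hence their cones are those of \<open>u'\<close> and of \<open>v\<close>.\<close>

abbreviation "P \<equiv> block T A M (Idt T (Cod T u)) (Zero T (Dom T u') (Cod T u)) g u'"
abbreviation "Q \<equiv> block T M B (\<ominus> v) (Zero T (Cod T u') (Cod T v)) (Zero T (Cod T u) (Cod T u')) (Idt T (Cod T u'))"

lemma alpha_factor: "Q \<cdot> P = \<alpha>"
  by (rule bip_into_eqI[of "Cod T v" "Cod T u'"]) simp_all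

lemma susp_P: "\<Sigma>a (prj1 M) \<cdot> \<Sigma>a P = \<Sigma>a (prj1 A)"
  "\<Sigma>a (prj2 M) \<cdot> \<Sigma>a P = (\<Sigma>a g \<cdot> \<Sigma>a (prj1 A)) \<boxplus> (\<Sigma>a u' \<cdot> \<Sigma>a (prj2 A))"
  by (subst susp_comp[symmetric]; simp)+

text \<open>The comparison map comes from TR3 towards \<open>(u', v', w')\<close>: project the
  source to X' and the target to Y' by \<open>(- g, 1)\<close>, which undoes the shear.\<close>

lemma P_distinguished: "(P, v' \<cdot> (\<ominus> (g \<cdot> prj1 M) \<boxplus> prj2 M), \<Sigma>a (inj2 A) \<cdot> w') \<in> \<Delta>"
  (is "(P, ?p, ?j) \<in> \<Delta>")
proof -
  obtain s t where E: "(P, s, t) \<in> \<Delta>" by (rule extend_arrow[of P]) simp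
  note [simp] = distD(2-8)[OF E]
  have Pt: "\<Sigma>a P \<cdot> t = Zero T (Cod T s) (\<Sigma>o (apex M))" using distD(9)[OF E] by simp
  \<comment> \<open>The first row of \<open>P\<close> is the projection to Y, so
    \<open>\<Sigma>P t = 0\<close> kills the first component of \<open>t\<close>; only the second
    has to be matched.\<close>
  have t1: "\<Sigma>a (prj1 A) \<cdot> t = Zero T (Cod T s) (\<Sigma>o (Cod T u))"
    using arg_cong[OF Pt, of "Comp T (\<Sigma>a (prj1 M))"] by (simp add: comp_reassoc[OF susp_P(1)])
  obtain \<chi> where \<chi>: "\<chi> \<in> Arr T" "Dom T \<chi> = Cod T s" "Cod T \<chi> = Cod T v'"
    "\<chi> \<cdot> s = v' \<cdot> (\<ominus> (g \<cdot> prj1 M) \<boxplus> prj2 M)" "w' \<cdot> \<chi> = \<Sigma>a (prj2 A) \<cdot> t"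
    by (rule triangle_map[OF E D2, of "prj2 A" "\<ominus> (g \<cdot> prj1 M) \<boxplus> prj2 M"]) simp_all
  have "?j \<cdot> \<chi> = t"
    by (rule susp_bip_into_eqI[of "Cod T u" "Dom T u'"]) (use \<chi> in \<open>simp_all add: t1\<close>)
  moreover have "candidate_triangle T (P, ?p, ?j)"
  proof -
    have "\<Sigma>a P \<cdot> ?j = Zero T (Cod T v') (\<Sigma>o (apex M))"
      by (rule susp_bip_into_eqI[of "Cod T u" "Cod T u'"]) (simp_all add: susp_P[THEN comp_reassoc])
    then show ?thesis by (simp add: candidate_iff del: candidate_triangle.simps)
  qed
  moreover have "hom_exact P ?p"
  proof (rule hom_exactI)
    fix b assume "b \<in> Arr T" "Cod T b = Cod T P" and 0: "?p \<cdot> b = Zero T (Dom T b) (Cod T ?p)"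
    then have [simp]: "b \<in> Arr T" "Cod T b = apex M" by simp_all
    let ?y = "\<ominus> (g \<cdot> (prj1 M \<cdot> b)) \<boxplus> (prj2 M \<cdot> b)"
    have "v' \<cdot> ?y = Zero T (Dom T b) (Cod T v')" using 0 by simp
    then obtain x where x: "x \<in> Arr T" "Dom T x = Dom T b" "Cod T x = Dom T u'" "u' \<cdot> x = ?y"
      using hom_exactE[OF hom_exact_dist[OF D2], of ?y] by auto
    let ?a = "(inj1 A \<cdot> (prj1 M \<cdot> b)) \<boxplus> (inj2 A \<cdot> x)"
    have "P \<cdot> ?a = b"
      by (rule bip_into_eqI[of "Cod T u" "Cod T u'"]) (use x in simp_all)
    then show "\<exists>a\<in>Arr T. Dom T a = Dom T b \<and> Cod T a = Dom T P \<and> P \<cdot> a = b"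
      using x by (intro bexI[of _ ?a]) simp_all
  qed
  moreover have "hom_exact ?p ?j"
  proof (rule hom_exactI)
    fix z assume "z \<in> Arr T" "Cod T z = Cod T ?p" and 0: "?j \<cdot> z = Zero T (Dom T z) (Cod T ?j)"
    then have [simp]: "z \<in> Arr T" "Cod T z = Cod T v'" by simp_all
    have "w' \<cdot> z = Zero T (Dom T z) (Cod T w')"
      using arg_cong[OF 0, of "Comp T (\<Sigma>a (prj2 A))"] by simp
    then obtain y where y: "y \<in> Arr T" "Dom T y = Dom T z" "Cod T y = Cod T u'" "v' \<cdot> y = z"
      using hom_exactE[OF hom_exact_dist'(1)[OF D2], of z] by auto
    then show "\<exists>y\<in>Arr T. Dom T y = Dom T z \<and> Cod T y = Dom T ?p \<and> ?p \<cdot> y = z"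
      by (intro bexI[of _ "inj2 M \<cdot> y"]) simp_all
  qed
  ultimately show ?thesis
    by (intro distinguishedI[OF _ _ _ E, of _ _ \<chi>]) (use \<chi> in simp_all)
qed

text \<open>Here the comparison goes to the rotated triangle on \<open>v\<close>; the minus on
  \<open>prj1 B\<close> compensates the sign of \<open>v\<close> in \<open>Q\<close>.\<close>

lemma Q_distinguished: "(Q, \<ominus> (w \<cdot> prj1 B), \<Sigma>a (inj1 M) \<cdot> \<ominus> (\<Sigma>a u)) \<in> \<Delta>"
  (is "(Q, ?p, ?j) \<in> \<Delta>")
proof -
  obtain s t where E: "(Q, s, t) \<in> \<Delta>" by (rule extend_arrow[of Q]) simp
  note [simp] = distD(2-8)[OF E]
  have Qt: "\<Sigma>a Q \<cdot> t = Zero T (Cod T s) (\<Sigma>o (apex B))" using distD(9)[OF E] by simp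
  have susp_Q: "\<Sigma>a (prj1 B) \<cdot> \<Sigma>a Q = \<ominus> (\<Sigma>a v \<cdot> \<Sigma>a (prj1 M))"
    "\<Sigma>a (prj2 B) \<cdot> \<Sigma>a Q = \<Sigma>a (prj2 M)"
    by (subst susp_comp[symmetric]; simp)+
  have t2: "\<Sigma>a (prj2 M) \<cdot> t = Zero T (Cod T s) (\<Sigma>o (Cod T u'))"
    using arg_cong[OF Qt, of "Comp T (\<Sigma>a (prj2 B))"] by (simp add: comp_reassoc[OF susp_Q(2)])
  obtain \<chi> where \<chi>: "\<chi> \<in> Arr T" "Dom T \<chi> = Cod T s" "Cod T \<chi> = Cod T w"
    "\<chi> \<cdot> s = w \<cdot> \<ominus> (prj1 B)" "\<ominus> (\<Sigma>a u) \<cdot> \<chi> = \<Sigma>a (prj1 M) \<cdot> t"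
    by (rule triangle_map[OF E rotate[OF D1], of "prj1 M" "\<ominus> (prj1 B)"]) simp_all
  have "?j \<cdot> \<chi> = t"
    by (rule susp_bip_into_eqI[of "Cod T u" "Cod T u'"]) (use \<chi> in \<open>simp_all add: t2\<close>)
  moreover have "candidate_triangle T (Q, ?p, ?j)"
  proof -
    have "\<Sigma>a Q \<cdot> ?j = Zero T (\<Sigma>o (Dom T u)) (\<Sigma>o (apex B))"
      by (rule susp_bip_into_eqI[of "Cod T v" "Cod T u'"]) (simp_all add: susp_Q[THEN comp_reassoc])
    then show ?thesis by (simp add: candidate_iff del: candidate_triangle.simps)
  qed
  moreover have "hom_exact Q ?p"
  proof (rule hom_exactI)
    fix b assume "b \<in> Arr T" "Cod T b = Cod T Q" and 0: "?p \<cdot> b = Zero T (Dom T b) (Cod T ?p)"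
    then have [simp]: "b \<in> Arr T" "Cod T b = apex B" by simp_all
    have "w \<cdot> (prj1 B \<cdot> b) = Zero T (Dom T b) (Cod T w)" using 0 by simp
    then obtain y where y: "y \<in> Arr T" "Dom T y = Dom T b" "Cod T y = Cod T u" "v \<cdot> y = prj1 B \<cdot> b"
      using hom_exactE[OF hom_exact_dist'(1)[OF D1], of "prj1 B \<cdot> b"] by auto
    let ?a = "(inj1 M \<cdot> \<ominus> y) \<boxplus> (inj2 M \<cdot> (prj2 B \<cdot> b))"
    have "Q \<cdot> ?a = b"
      by (rule bip_into_eqI[of "Cod T v" "Cod T u'"]) (use y in simp_all)
    then show "\<exists>a\<in>Arr T. Dom T a = Dom T b \<and> Cod T a = Dom T Q \<and> Q \<cdot> a = b"
      using y by (intro bexI[of _ ?a]) simp_all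
  qed
  moreover have "hom_exact ?p ?j"
  proof (rule hom_exactI)
    fix x assume "x \<in> Arr T" "Cod T x = Cod T ?p" and 0: "?j \<cdot> x = Zero T (Dom T x) (Cod T ?j)"
    then have [simp]: "x \<in> Arr T" "Cod T x = \<Sigma>o (Dom T u)" by simp_all
    have "\<Sigma>a u \<cdot> x = Zero T (Dom T x) (Cod T (\<Sigma>a u))"
      using arg_cong[OF 0, of "Comp T (\<Sigma>a (prj1 M))"] by simp
    then obtain z where z: "z \<in> Arr T" "Dom T z = Dom T x" "Cod T z = Cod T v" "w \<cdot> z = x"
      using hom_exactE[OF hom_exact_dist'(2)[OF D1], of x] by auto
    then show "\<exists>z\<in>Arr T. Dom T z = Dom T x \<and> Cod T z = Dom T ?p \<and> ?p \<cdot> z = x"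
      by (intro bexI[of _ "inj1 B \<cdot> \<ominus> z"]) simp_all
  qed
  ultimately show ?thesis
    by (intro distinguishedI[OF _ _ _ E, of _ _ \<chi>]) (use \<chi> in simp_all)
qed

text \<open>The octahedron over \<open>Q \<cdot> P = \<alpha>\<close> gives \<open>U\<close> from Z'
  to E and \<open>V\<close> from E to \<Sigma>X. The components of \<open>\<phi>\<close> are
  \<open>V\<close> and a map \<open>\<rho>\<close> with \<open>1 = \<psi> V + U \<rho>\<close>,
  where \<open>\<psi>\<close> is a section of \<open>V\<close>.\<close>

lemma TR4_comparison:
  assumes TR4: "TR4 T \<Delta>" and E: "(\<alpha>, s, t) \<in> \<Delta>"
  shows "\<exists>\<phi>\<in>mor T (Cod T s) (apex C). (\<exists>h\<in>mor T (Cod T v) (Cod T v'). \<phi> \<cdot> s = \<beta> h) \<and> \<gamma> \<cdot> \<phi> = t"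
proof -
  define p where "p = v' \<cdot> (\<ominus> (g \<cdot> prj1 M) \<boxplus> prj2 M)"
  define j where "j = \<Sigma>a (inj2 A) \<cdot> w'"
  define r where "r = \<ominus> (w \<cdot> prj1 B)"
  define k where "k = \<Sigma>a (inj1 M) \<cdot> \<ominus> (\<Sigma>a u)"
  note [simp] = distD(2-8)[OF E, unfolded alpha_arr]
  have [simp]: "p \<in> Arr T" "Dom T p = apex M" "Cod T p = Cod T v'"
    "j \<in> Arr T" "Dom T j = Cod T v'" "Cod T j = \<Sigma>o (apex A)"
    "r \<in> Arr T" "Dom T r = apex B" "Cod T r = \<Sigma>o (Dom T u)"
    "k \<in> Arr T" "Dom T k = \<Sigma>o (Dom T u)" "Cod T k = \<Sigma>o (apex M)"
    by (simp_all add: p_def j_def r_def k_def)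
  have "Cod T P = Dom T Q \<and> (P, p, j) \<in> \<Delta> \<and> (Q, r, k) \<in> \<Delta> \<and> (Q \<cdot> P, s, t) \<in> \<Delta>"
    using P_distinguished Q_distinguished E unfolding alpha_factor p_def j_def r_def k_def by simp
  then obtain U V where U: "U \<in> mor T (Cod T p) (Cod T s)" and V: "V \<in> mor T (Cod T s) (Cod T r)"
    and Up: "U \<cdot> p = s \<cdot> Q" and Vs: "V \<cdot> s = r" and tU: "t \<cdot> U = j" and kV: "k \<cdot> V = \<Sigma>a P \<cdot> t"
    and UV: "(U, V, \<Sigma>a p \<cdot> k) \<in> \<Delta>"
    using TR4[unfolded TR4_def, rule_format, of P Q p j r k s t] by blast
  have [simp]: "U \<in> Arr T" "Dom T U = Cod T v'" "Cod T U = Cod T s"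
    "V \<in> Arr T" "Dom T V = Cod T s" "Cod T V = \<Sigma>o (Dom T u)"
    using U V by (simp_all add: mor_def)
  \<comment> \<open>The connecting map is \<open>\<Sigma>v' \<Sigma>g \<Sigma>u\<close>, which
    equals \<open>\<Sigma>v' \<Sigma>u' \<Sigma>f = 0\<close>. Therefore \<open>U\<close> can be
    cancelled on the left and \<open>V\<close> has a section.\<close>
  have pk: "\<Sigma>a p \<cdot> k = Zero T (\<Sigma>o (Dom T u)) (\<Sigma>o (Cod T v'))"
    by (simp add: p_def k_def susp_square)
  note UV' = UV[unfolded pk]
  have VU: "V \<cdot> U = Zero T (Cod T v') (\<Sigma>o (Dom T u))" using distD(7)[OF UV] by simp
  have U_mono: "x = Zero T (Dom T x) (Cod T v')"
    if [simp]: "x \<in> Arr T" "Cod T x = Cod T v'" and 0: "U \<cdot> x = Zero T (Dom T x) (Cod T s)" for x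
  proof -
    have "\<Sigma>a U \<cdot> \<Sigma>a x = Zero T (\<Sigma>o (Dom T x)) (\<Sigma>o (Cod T s))"
      using arg_cong[OF 0, of "\<Sigma>a"] by simp
    then obtain z where "z \<in> Arr T" "Dom T z = \<Sigma>o (Dom T x)" "Cod T z = \<Sigma>o (Dom T u)"
      "Zero T (\<Sigma>o (Dom T u)) (\<Sigma>o (Cod T v')) \<cdot> z = \<Sigma>a x"
      using hom_exactE[OF hom_exact_dist'(2)[OF UV'], of "\<Sigma>a x"] by auto
    then have "\<Sigma>a x = \<Sigma>a (Zero T (Dom T x) (Cod T v'))" by simp
    then show ?thesis
      by (intro susp_faithful[of x "Dom T x" "Cod T v'"]) (simp_all add: mor_def)
  qed
  obtain \<psi>\<^sub>1 where \<psi>1 [simp]: "\<psi>\<^sub>1 \<in> Arr T" "Dom T \<psi>\<^sub>1 = \<Sigma>o (Dom T u)" "Cod T \<psi>\<^sub>1 = Cod T s"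
    and V\<psi>1: "V \<cdot> \<psi>\<^sub>1 = Idt T (\<Sigma>o (Dom T u))"
    by (rule hom_exactE[OF hom_exact_dist'(1)[OF UV'], of "Idt T (\<Sigma>o (Dom T u))"]) simp_all
  \<comment> \<open>The Y-component of \<open>k V = \<Sigma>P t\<close> already gives the first row
    of \<open>\<gamma> \<phi> = t\<close>, since \<open>V\<close> is to be the first component of
    \<open>\<phi>\<close>.\<close>
  have t1: "\<Sigma>a (prj1 A) \<cdot> t = \<ominus> (\<Sigma>a u \<cdot> V)"
    using arg_cong[OF kV, of "Comp T (\<Sigma>a (prj1 M))"]
    by (simp add: comp_reassoc[OF susp_P(1)] k_def)
  define t2 where "t2 = \<Sigma>a (prj2 A) \<cdot> t"
  have [simp]: "t2 \<in> Arr T" "Dom T t2 = Cod T s" "Cod T t2 = \<Sigma>o (Dom T u')"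
    by (simp_all add: t2_def)
  have "(\<Sigma>a g \<cdot> \<ominus> (\<Sigma>a u \<cdot> V)) \<boxplus> (\<Sigma>a u' \<cdot> t2) = Zero T (Cod T s) (\<Sigma>o (Cod T u'))"
    using arg_cong[OF kV, of "Comp T (\<Sigma>a (prj2 M))"]
    by (simp add: comp_reassoc[OF susp_P(2)] k_def t1 t2_def)
  then have ut2: "\<Sigma>a u' \<cdot> t2 = \<Sigma>a u' \<cdot> (\<Sigma>a f \<cdot> V)"
    by (simp add: add_eq_zero_iff comp_reassoc[OF susp_square])
  have t2U: "t2 \<cdot> U = w'" by (simp add: t2_def tU) (simp add: j_def)
  \<comment> \<open>An arbitrary section \<open>\<psi>\<^sub>1\<close> satisfies
    \<open>t2 \<psi>\<^sub>1 = \<Sigma>f\<close> only after applying \<open>\<Sigma>u'\<close>. The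
    error lifts to \<open>m\<close> along \<open>w'\<close>, and \<open>t2 U = w'\<close> allows it
    to be subtracted through \<open>U\<close> without disturbing \<open>V\<close>.\<close>
  have "\<Sigma>a u' \<cdot> ((t2 \<cdot> \<psi>\<^sub>1) \<boxplus> \<ominus> (\<Sigma>a f)) = Zero T (\<Sigma>o (Dom T u)) (\<Sigma>o (Cod T u'))"
    by (simp add: comp_reassoc[OF ut2] V\<psi>1)
  then obtain m where m [simp]: "m \<in> Arr T" "Dom T m = \<Sigma>o (Dom T u)" "Cod T m = Cod T v'"
    and wm: "w' \<cdot> m = (t2 \<cdot> \<psi>\<^sub>1) \<boxplus> \<ominus> (\<Sigma>a f)"
    using hom_exactE[OF hom_exact_dist'(2)[OF D2], of "(t2 \<cdot> \<psi>\<^sub>1) \<boxplus> \<ominus> (\<Sigma>a f)"] by auto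
  \<comment> \<open>the correction makes the second component of \<open>t \<psi>\<close> equal to \<open>\<Sigma>f\<close>\<close>
  define \<psi> where "\<psi> = \<psi>\<^sub>1 \<boxplus> \<ominus> (U \<cdot> m)"
  have \<psi> [simp]: "\<psi> \<in> Arr T" "Dom T \<psi> = \<Sigma>o (Dom T u)" "Cod T \<psi> = Cod T s"
    by (simp_all add: \<psi>_def)
  have V\<psi>: "V \<cdot> \<psi> = Idt T (\<Sigma>o (Dom T u))"
    by (simp add: \<psi>_def V\<psi>1 comp_reassoc[OF VU])
  have t2\<psi>: "t2 \<cdot> \<psi> = \<Sigma>a f"
    by (simp add: \<psi>_def comp_reassoc[OF t2U] wm)
  have "V \<cdot> (Idt T (Cod T s) \<boxplus> \<ominus> (\<psi> \<cdot> V)) = Zero T (Cod T s) (\<Sigma>o (Dom T u))"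
    by (simp add: comp_reassoc[OF V\<psi>])
  then obtain \<rho> where \<rho> [simp]: "\<rho> \<in> Arr T" "Dom T \<rho> = Cod T s" "Cod T \<rho> = Cod T v'"
    and U\<rho>: "U \<cdot> \<rho> = Idt T (Cod T s) \<boxplus> \<ominus> (\<psi> \<cdot> V)"
    using hom_exactE[OF hom_exact_dist[OF UV], of "Idt T (Cod T s) \<boxplus> \<ominus> (\<psi> \<cdot> V)"] by auto
  define \<phi> where "\<phi> = (inj1 C \<cdot> V) \<boxplus> (inj2 C \<cdot> \<rho>)"
  have \<phi> [simp]: "\<phi> \<in> Arr T" "Dom T \<phi> = Cod T s" "Cod T \<phi> = apex C"
    and p\<phi>: "prj1 C \<cdot> \<phi> = V" "prj2 C \<cdot> \<phi> = \<rho>"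
    by (simp_all add: \<phi>_def)
  note re\<phi> = p\<phi> p\<phi>[THEN comp_reassoc] Vs Vs[THEN comp_reassoc]
  \<comment> \<open>The lower left entry of \<open>\<beta>\<close> is free, so \<open>h\<close> is
    simply read off from \<open>\<phi> s\<close>. The upper row comes from \<open>V s = r\<close>,
    and only the lower right entry remains to be identified with \<open>v'\<close>.\<close>
  define h where "h = \<rho> \<cdot> (s \<cdot> inj1 B)"
  have h [simp]: "h \<in> Arr T" "Dom T h = Cod T v" "Cod T h = Cod T v'"
    by (simp_all add: h_def)
  \<comment> \<open>Both candidates for the lower right entry become \<open>s \<cdot> inj2 B\<close>
    after \<open>U\<close>: one because \<open>r\<close> vanishes on Y', the other by
    \<open>U p = s Q\<close>. Then \<open>U_mono\<close> applies.\<close>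
  have "U \<cdot> (\<rho> \<cdot> (s \<cdot> inj2 B)) = s \<cdot> inj2 B"
    by (simp add: comp_reassoc[OF U\<rho>] re\<phi>) (simp add: r_def)
  moreover have "Q \<cdot> inj2 M = inj2 B"
    by (rule bip_into_eqI[of "Cod T v" "Cod T u'"]) simp_all
  then have "U \<cdot> (p \<cdot> inj2 M) = s \<cdot> inj2 B"
    by (simp add: comp_reassoc[OF Up])
  then have "U \<cdot> v' = s \<cdot> inj2 B" by (simp add: p_def)
  ultimately have "U \<cdot> ((\<rho> \<cdot> (s \<cdot> inj2 B)) \<boxplus> \<ominus> v') = Zero T (Cod T u') (Cod T s)"
    by simp
  then have "(\<rho> \<cdot> (s \<cdot> inj2 B)) \<boxplus> \<ominus> v' = Zero T (Cod T u') (Cod T v')"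
    using U_mono[of "(\<rho> \<cdot> (s \<cdot> inj2 B)) \<boxplus> \<ominus> v'"] by simp
  then have \<rho>s: "\<rho> \<cdot> (s \<cdot> inj2 B) = v'" by (simp add: add_eq_zero_iff neg_inject)
  have "\<phi> \<cdot> s = \<beta> h"
    by (subst block_eq_iff) (simp_all add: re\<phi> \<rho>s h_def, simp_all add: r_def)
  moreover have "\<gamma> \<cdot> \<phi> = t"
  proof (rule susp_bip_into_eqI[of "Cod T u" "Dom T u'"])
    \<comment> \<open>Applying \<open>t2\<close> to the decomposition of the identity of E gives the
      second row of \<open>\<gamma> \<phi> = t\<close>.\<close>
    have "t2 \<cdot> ((\<psi> \<cdot> V) \<boxplus> (U \<cdot> \<rho>)) = t2" unfolding U\<rho> by (simp add: add_ac)
    then have "(\<Sigma>a f \<cdot> V) \<boxplus> (w' \<cdot> \<rho>) = t2"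
      by (simp add: comp_reassoc[OF t2U] comp_reassoc[OF t2\<psi>] del: add_cancel_outer)
    then show "\<Sigma>a (prj2 A) \<cdot> (\<gamma> \<cdot> \<phi>) = \<Sigma>a (prj2 A) \<cdot> t"
      by (simp add: p\<phi> t2_def)
  qed (simp_all add: p\<phi> t1)
  ultimately show ?thesis
    by (intro bexI[of _ \<phi>] conjI bexI[of _ h]) (simp_all add: mor_def)
qed

end

section \<open>The equivalences\<close>

lemma (in pretriangulated) comp_square_initial:
  assumes "comp_square T \<Delta> g f q" "f \<in> Arr T" "g \<in> Arr T" "Cod T f = Dom T g"
  shows "initial_square T \<Delta> q"
  using assms by (auto simp: comp_square_def mor_def)

text \<open>The functions \<open>cone\<close> and \<open>sq\<close> stand for the choices of a
  triangle on \<alpha> and of the triangles in q(g o f). They are arbitrary, so the result holds for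
  every choice.\<close>

theorem theoremA:
  fixes T :: "('o, 'm) suspended_cat"
    and \<Delta> :: "'m triangle set"
    and cone :: "'m square \<Rightarrow> 'm \<times> 'm"
    and sq :: "'m \<Rightarrow> 'm \<Rightarrow> 'm square"
  assumes pretri: "pre_triangulated T \<Delta>"
    and cone: "\<And>q. initial_square T \<Delta> q \<Longrightarrow> cone_choice T \<Delta> q (cone q)"
    and sq: "\<And>f g. f \<in> Arr T \<Longrightarrow> g \<in> Arr T \<Longrightarrow> Cod T f = Dom T g \<Longrightarrow> comp_square T \<Delta> g f (sq g f)"
  shows "(\<forall>q. initial_square T \<Delta> q \<longrightarrow>
            ((\<exists>h. good_completion T \<Delta> q h) \<longleftrightarrow> obstruction T q (cone q) = \<one>\<^bsub>Obs T q (cone q)\<^esub>)) \<and>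
         (TR4 T \<Delta> \<longleftrightarrow>
            (\<forall>q. initial_square T \<Delta> q \<longrightarrow> obstruction T q (cone q) = \<one>\<^bsub>Obs T q (cone q)\<^esub>)) \<and>
         ((\<forall>q. initial_square T \<Delta> q \<longrightarrow> obstruction T q (cone q) = \<one>\<^bsub>Obs T q (cone q)\<^esub>) \<longleftrightarrow>
            (\<forall>f\<in>Arr T. \<forall>g\<in>Arr T. Cod T f = Dom T g \<longrightarrow>
               obstruction T (sq g f) (cone (sq g f)) = \<one>\<^bsub>Obs T (sq g f) (cone (sq g f))\<^esub>))"
proof -
  have susp: "suspended_category T" using pretri by (simp add: pre_triangulated_def)
  then have "additive_category T" by (simp add: suspended_category_def)
  with susp pretri interpret pretriangulated T \<Delta>
    by unfold_locales
  let ?obs0 = "\<lambda>q. obstruction T q (cone q) = \<one>\<^bsub>Obs T q (cone q)\<^esub>"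
  have choice: "(cone_alpha T q, fst (cone q), snd (cone q)) \<in> \<Delta>" if "initial_square T \<Delta> q" for q
    using cone[OF that] by (simp add: cone_choice_def)
  have obs: "?obs0 q \<longleftrightarrow> (\<exists>h. good_completion T \<Delta> q h)" if q: "initial_square T \<Delta> q" for q
  proof -
    obtain u v w u' v' w' f g where q_eq: "q = ((u, v, w), (u', v', w'), f, g)"
      by (metis surj_pair)
    interpret S: square T \<Delta> u v w u' v' w' f g
      using q unfolding q_eq by unfold_locales
    have E: "(S.\<alpha>, fst (cone q), snd (cone q)) \<in> \<Delta>"
      using choice[OF q] unfolding q_eq by (simp add: Let_def)
    show ?thesis
      using S.obstruction_eq_one_iff[OF E] S.good_completion_iff[OF E] unfolding q_eq by simp
  qed
  have i_ii: "?obs0 q" if TR4: "TR4 T \<Delta>" and q: "initial_square T \<Delta> q" for q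
  proof -
    obtain u v w u' v' w' f g where q_eq: "q = ((u, v, w), (u', v', w'), f, g)"
      by (metis surj_pair)
    interpret S: square T \<Delta> u v w u' v' w' f g
      using q unfolding q_eq by unfold_locales
    have E: "(S.\<alpha>, fst (cone q), snd (cone q)) \<in> \<Delta>"
      using choice[OF q] unfolding q_eq by (simp add: Let_def)
    show ?thesis
      using S.obstruction_eq_one_iff[OF E] S.TR4_comparison[OF TR4 E] unfolding q_eq by simp
  qed
  have sq_initial: "initial_square T \<Delta> (sq g f)" if "f \<in> Arr T" "g \<in> Arr T" "Cod T f = Dom T g" for f g
    using comp_square_initial[OF sq[OF that] that] .
  \<comment> \<open>Vanishing on the chosen squares is first turned into good completions by
    \<open>obs\<close>; one square for each composable pair is enough for
    \<open>TR4_if_good_completions\<close>.\<close>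
  have iii_i: "TR4 T \<Delta>"
    if "\<forall>f\<in>Arr T. \<forall>g\<in>Arr T. Cod T f = Dom T g \<longrightarrow> ?obs0 (sq g f)"
    by (rule TR4_if_good_completions) (use that sq sq_initial obs in blast)
  show ?thesis using obs i_ii iii_i sq_initial by blast
qed

end
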